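(* Let $n\ge4$. Up to isomorphism there are four (parametrized families of) solvable indecomposable right Leibniz algebras over $\mathbb{C}$ of dimension $n+2$ whose nilradical is $\mathcal{L}^4$ (a nilradical of codimension two): the algebra (i) for $n\ge5$, and the algebras (ii), (iii), (iv) for $n=4$. That is, each algebra listed below is such an algebra, and every such algebra is isomorphic to one of those listed, for some admissible complex values of the parameters. In (ii)–(iv) the parameters are in addition such that no nontrivial linear combination of the restrictions to $\mathcal{L}^4$ of the right multiplications $x\mapsto[x,e_5]$ and $x\mapsto[x,e_6]$ is nilpotent. In each item the brackets are those of $\mathcal{L}^4$ on $e_1,\dots,e_n$ together with the ones displayed. (i) $\mathfrak{g}_{n+2,1}$ $(n\ge5)$: $[e_1,e_{n+1}]=e_1+e_3$, $[e_2,e_{n+1}]=4e_2$, $[e_3,e_{n+1}]=2e_3$, $[e_4,e_{n+1}]=e_2+3e_4$, $[e_i,e_{n+1}]=(i-1)e_i$, $[e_{n+1},e_1]=-e_1-e_3$, $[e_{n+1},e_3]=-2e_3$, $[e_{n+1},e_4]=3(e_2-e_4)$, $[e_{n+1},e_i]=(1-i)e_i$, $[e_1,e_{n+2}]=e_1$, $[e_2,e_{n+2}]=2e_2$, $[e_j,e_{n+2}]=(j-2)e_j$ $(3\le j\le n)$, $[e_{n+2},e_1]=-e_1$, $[e_{n+2},e_3]=-e_3$, $[e_{n+2},e_4]=2(e_2-e_4)$, $[e_{n+2},e_i]=(2-i)e_i$, $(5\le i\le n)$. (ii) $\mathfrak{g}_{6,2}$ $(n=4)$: $[e_1,e_5]=e_1$,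 $[e_2,e_5]=2e_2$, $[e_3,e_5]=e_3$, $[e_4,e_5]=2e_4$, $[e_5,e_1]=-e_1$, $[e_5,e_3]=-e_3$, $[e_5,e_4]=2(e_2-e_4)$, $[e_1,e_6]=e_1+be_3$, $[e_2,e_6]=2(b+1)e_2$, $[e_3,e_6]=e_1+be_3$, $[e_4,e_6]=(b+1)(e_2+e_4)$, $[e_6,e_1]=-e_1-be_3$, $[e_6,e_3]=-e_1-be_3$, $[e_6,e_4]=(b+1)(e_2-e_4)$, where $b\ne-1$. (iii) $\mathfrak{g}_{6,3}$ $(n=4)$: $[e_1,e_5]=e_1+(c+1)e_3$, $[e_2,e_5]=2(c+2)e_2$, $[e_3,e_5]=ce_1+2e_3$, $[e_4,e_5]=(2c+1)e_2+3e_4$, $[e_5,e_1]=-e_1-(c+1)e_3$, $[e_5,e_3]=-ce_1-2e_3$, $[e_5,e_4]=3(e_2-e_4)$, $[e_1,e_6]=e_1$, $[e_2,e_6]=2e_2$, $[e_3,e_6]=e_3$, $[e_4,e_6]=2e_4$, $[e_6,e_1]=-e_1$, $[e_6,e_3]=-e_3$, $[e_6,e_4]=2(e_2-e_4)$, where $c\ne-2$. (iv) $\mathfrak{g}_{6,4}$ $(n=4)$: $[e_1,e_5]=e_1$, $[e_2,e_5]=2e_2$, $[e_3,e_5]=e_3$, $[e_4,e_5]=2e_4$, $[e_5,e_1]=-e_1$, $[e_5,e_3]=-e_3$, $[e_5,e_4]=2(e_2-e_4)$, $[e_1,e_6]=be_1+(1-b)e_3$, $[e_2,e_6]=2e_2$,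 $[e_3,e_6]=e_1$, $[e_4,e_6]=(2-b)e_2+be_4$, $[e_6,e_1]=-be_1+(b-1)e_3$, $[e_6,e_3]=-e_1$, $[e_6,e_4]=b(e_2-e_4)$, where $b\ne0$.
   Context: All algebras are finite dimensional over $\mathbb{C}$. A right Leibniz algebra is a vector space $L$ with a bilinear bracket satisfying $[[x,y],z]=[[x,z],y]+[x,[y,z]]$ for all $x,y,z\in L$. $L$ is nilpotent (solvable) if the series $L^0=L$, $L^{k+1}=[L^k,L]$ (resp. $L^{(0)}=L$, $L^{(k+1)}=[L^{(k)},L^{(k)}]$) reaches $0$. The nilradical of a solvable Leibniz algebra is its unique maximal nilpotent (two-sided) ideal. An algebra is indecomposable if it is not a direct sum of two nonzero ideals. For $n\ge4$, $\mathcal{L}^4$ is the $n$-dimensional nilpotent Leibniz algebra with basis $e_1,\dots,e_n$ and only nonzero brackets $[e_1,e_1]=e_2$, $[e_i,e_1]=e_{i+1}$ $(3\le i\le n-1)$, $[e_1,e_3]=2e_2-e_4$, $[e_3,e_3]=e_2$, $[e_1,e_j]=-e_{j+1}$ $(4\le j\le n-1)$. The extended algebra has basis $e_1,\dots,e_n,e_{n+1},e_{n+2}$. Brackets of basis elements that are neither displayed nor among those of $\mathcal{L}^4$ are zero. *)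

theory Defs
  imports Complex_Main "HOL-Library.Function_Algebras"
begin

section \<open>Right Leibniz algebras on a subspace of a complex vector space\<close>

text \<open>The algebra is carried by a subspace \<open>L\<close> of an ambient vector space, so that algebras of
  dimension depending on a natural number, and ideals, can be treated uniformly. The values of
  \<open>br\<close> outside \<open>L\<close> are irrelevant.\<close>

locale leibniz_algebra = vector_space scale
  for scale :: "complex \<Rightarrow> 'a::ab_group_add \<Rightarrow> 'a" +
  fixes L :: "'a set" and br :: "'a \<Rightarrow> 'a \<Rightarrow> 'a"
  assumes subspace_carrier: "subspace L"
    and br_closed: "\<lbrakk>x \<in> L; y \<in> L\<rbrakk> \<Longrightarrow> br x y \<in> L"
    and br_add_left: "\<lbrakk>x \<in> L; y \<in> L; z \<in> L\<rbrakk> \<Longrightarrow> br (x + y) z = br x z + br y z"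
    and br_add_right: "\<lbrakk>x \<in> L; y \<in> L; z \<in> L\<rbrakk> \<Longrightarrow> br x (y + z) = br x y + br x z"
    and br_scale_left: "\<lbrakk>x \<in> L; y \<in> L\<rbrakk> \<Longrightarrow> br (scale c x) y = scale c (br x y)"
    and br_scale_right: "\<lbrakk>x \<in> L; y \<in> L\<rbrakk> \<Longrightarrow> br x (scale c y) = scale c (br x y)"
    and leibniz: "\<lbrakk>x \<in> L; y \<in> L; z \<in> L\<rbrakk> \<Longrightarrow> br (br x y) z = br (br x z) y + br x (br y z)"

definition bracket_span ::
  "(complex \<Rightarrow> 'a \<Rightarrow> 'a) \<Rightarrow> ('a \<Rightarrow> 'a \<Rightarrow> 'a) \<Rightarrow> 'a set \<Rightarrow> 'a set \<Rightarrow> 'a::ab_group_add set" where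
  "bracket_span scale br A B = module.span scale {br a b | a b. a \<in> A \<and> b \<in> B}"

primrec lower_series ::
  "(complex \<Rightarrow> 'a \<Rightarrow> 'a) \<Rightarrow> ('a \<Rightarrow> 'a \<Rightarrow> 'a) \<Rightarrow> 'a set \<Rightarrow> nat \<Rightarrow> 'a::ab_group_add set" where
  "lower_series scale br A 0 = A"
| "lower_series scale br A (Suc k) = bracket_span scale br (lower_series scale br A k) A"

primrec derived_series ::
  "(complex \<Rightarrow> 'a \<Rightarrow> 'a) \<Rightarrow> ('a \<Rightarrow> 'a \<Rightarrow> 'a) \<Rightarrow> 'a set \<Rightarrow> nat \<Rightarrow> 'a::ab_group_add set" where
  "derived_series scale br A 0 = A"
| "derived_series scale br A (Suc k) =
     bracket_span scale br (derived_series scale br A k) (derived_series scale br A k)"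

definition nilpotent_alg ::
  "(complex \<Rightarrow> 'a \<Rightarrow> 'a) \<Rightarrow> 'a::ab_group_add set \<Rightarrow> ('a \<Rightarrow> 'a \<Rightarrow> 'a) \<Rightarrow> bool" where
  "nilpotent_alg scale A br \<longleftrightarrow> (\<exists>k. lower_series scale br A k = {0})"

definition solvable_alg ::
  "(complex \<Rightarrow> 'a \<Rightarrow> 'a) \<Rightarrow> 'a::ab_group_add set \<Rightarrow> ('a \<Rightarrow> 'a \<Rightarrow> 'a) \<Rightarrow> bool" where
  "solvable_alg scale A br \<longleftrightarrow> (\<exists>k. derived_series scale br A k = {0})"

definition two_sided_ideal ::
  "(complex \<Rightarrow> 'a \<Rightarrow> 'a) \<Rightarrow> 'a::ab_group_add set \<Rightarrow> ('a \<Rightarrow> 'a \<Rightarrow> 'a) \<Rightarrow> 'a set \<Rightarrow> bool" where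
  "two_sided_ideal scale L br I \<longleftrightarrow> module.subspace scale I \<and> I \<subseteq> L \<and>
     (\<forall>x\<in>L. \<forall>y\<in>I. br x y \<in> I \<and> br y x \<in> I)"

definition maximal_nilpotent_ideal ::
  "(complex \<Rightarrow> 'a \<Rightarrow> 'a) \<Rightarrow> 'a::ab_group_add set \<Rightarrow> ('a \<Rightarrow> 'a \<Rightarrow> 'a) \<Rightarrow> 'a set \<Rightarrow> bool" where
  "maximal_nilpotent_ideal scale L br N \<longleftrightarrow>
     two_sided_ideal scale L br N \<and> nilpotent_alg scale N br \<and>
     (\<forall>M. two_sided_ideal scale L br M \<and> nilpotent_alg scale M br \<and> N \<subseteq> M \<longrightarrow> M = N)"

definition is_nilradical ::
  "(complex \<Rightarrow> 'a \<Rightarrow> 'a) \<Rightarrow> 'a::ab_group_add set \<Rightarrow> ('a \<Rightarrow> 'a \<Rightarrow> 'a) \<Rightarrow> 'a set \<Rightarrow> bool" where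
  "is_nilradical scale L br N \<longleftrightarrow> maximal_nilpotent_ideal scale L br N \<and>
     (\<forall>M. maximal_nilpotent_ideal scale L br M \<longrightarrow> M = N)"

definition indecomposable_alg ::
  "(complex \<Rightarrow> 'a \<Rightarrow> 'a) \<Rightarrow> 'a::ab_group_add set \<Rightarrow> ('a \<Rightarrow> 'a \<Rightarrow> 'a) \<Rightarrow> bool" where
  "indecomposable_alg scale L br \<longleftrightarrow>
     \<not> (\<exists>I J. two_sided_ideal scale L br I \<and> two_sided_ideal scale L br J \<and>
           I \<noteq> {0} \<and> J \<noteq> {0} \<and> I \<inter> J = {0} \<and> {x + y | x y. x \<in> I \<and> y \<in> J} = L)"

definition alg_isomorphic ::
  "(complex \<Rightarrow> 'a \<Rightarrow> 'a) \<Rightarrow> 'a::ab_group_add set \<Rightarrow> ('a \<Rightarrow> 'a \<Rightarrow> 'a) \<Rightarrow>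
   (complex \<Rightarrow> 'b \<Rightarrow> 'b) \<Rightarrow> 'b::ab_group_add set \<Rightarrow> ('b \<Rightarrow> 'b \<Rightarrow> 'b) \<Rightarrow> bool" where
  "alg_isomorphic scale L br scale' L' br' \<longleftrightarrow>
     (\<exists>f. bij_betw f L L' \<and>
          (\<forall>x\<in>L. \<forall>y\<in>L. f (x + y) = f x + f y) \<and>
          (\<forall>c. \<forall>x\<in>L. f (scale c x) = scale' c (f x)) \<and>
          (\<forall>x\<in>L. \<forall>y\<in>L. f (br x y) = br' (f x) (f y)))"


section \<open>Algebras given by a multiplication table\<close>

text \<open>The \<open>m\<close>-dimensional space with basis \<open>\<e> 1, \<dots>, \<e> m\<close> is realised as the functions
  \<open>nat \<Rightarrow> complex\<close> vanishing outside \<open>{1..m}\<close>.\<close>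

definition cscale :: "complex \<Rightarrow> (nat \<Rightarrow> complex) \<Rightarrow> nat \<Rightarrow> complex" (infixr "\<cdot>" 75) where
  "c \<cdot> v = (\<lambda>k. c * v k)"

definition coords :: "nat \<Rightarrow> (nat \<Rightarrow> complex) set" where
  "coords m = {v. \<forall>k. k \<notin> {1..m} \<longrightarrow> v k = 0}"

definition basis_vec :: "nat \<Rightarrow> nat \<Rightarrow> complex" ("\<e>") where
  "\<e> i = (\<lambda>k. if k = i then 1 else 0)"

type_synonym table = "((nat \<times> nat) \<times> (nat \<Rightarrow> complex)) list"

text \<open>An entry \<open>((i, j), v)\<close> of a table stands for the bracket \<open>[\<e> i, \<e> j] = v\<close>; brackets of basis
  vectors without an entry are zero. No pair \<open>(i, j)\<close> occurs twice in the tables below.\<close>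

definition basis_bracket :: "table \<Rightarrow> nat \<Rightarrow> nat \<Rightarrow> nat \<Rightarrow> complex" where
  "basis_bracket T i j = (case map_of T (i, j) of Some v \<Rightarrow> v | None \<Rightarrow> 0)"

definition table_bracket ::
  "nat \<Rightarrow> table \<Rightarrow> (nat \<Rightarrow> complex) \<Rightarrow> (nat \<Rightarrow> complex) \<Rightarrow> nat \<Rightarrow> complex" where
  "table_bracket m T x y = (\<Sum>i=1..m. \<Sum>j=1..m. (x i * y j) \<cdot> basis_bracket T i j)"

definition L4_table :: "nat \<Rightarrow> table" where
  "L4_table n =
     [((1, 1), \<e> 2), ((1, 3), 2 \<cdot> \<e> 2 - \<e> 4), ((3, 3), \<e> 2)] @
     [((i, 1), \<e> (i + 1)). i \<leftarrow> [3..<n]] @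
     [((1, j), - \<e> (j + 1)). j \<leftarrow> [4..<n]]"

definition L4_bracket :: "nat \<Rightarrow> (nat \<Rightarrow> complex) \<Rightarrow> (nat \<Rightarrow> complex) \<Rightarrow> nat \<Rightarrow> complex" where
  "L4_bracket n = table_bracket n (L4_table n)"

definition g1_bracket :: "nat \<Rightarrow> (nat \<Rightarrow> complex) \<Rightarrow> (nat \<Rightarrow> complex) \<Rightarrow> nat \<Rightarrow> complex" where
  "g1_bracket n = table_bracket (n + 2) (L4_table n @
     [((1, n+1), \<e> 1 + \<e> 3), ((2, n+1), 4 \<cdot> \<e> 2), ((3, n+1), 2 \<cdot> \<e> 3),
      ((4, n+1), \<e> 2 + 3 \<cdot> \<e> 4)] @
     [((i, n+1), (of_nat i - 1) \<cdot> \<e> i). i \<leftarrow> [5..<n+1]] @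
     [((n+1, 1), - \<e> 1 - \<e> 3), ((n+1, 3), (-2) \<cdot> \<e> 3), ((n+1, 4), 3 \<cdot> (\<e> 2 - \<e> 4))] @
     [((n+1, i), (1 - of_nat i) \<cdot> \<e> i). i \<leftarrow> [5..<n+1]] @
     [((1, n+2), \<e> 1), ((2, n+2), 2 \<cdot> \<e> 2)] @
     [((j, n+2), (of_nat j - 2) \<cdot> \<e> j). j \<leftarrow> [3..<n+1]] @
     [((n+2, 1), - \<e> 1), ((n+2, 3), - \<e> 3), ((n+2, 4), 2 \<cdot> (\<e> 2 - \<e> 4))] @
     [((n+2, i), (2 - of_nat i) \<cdot> \<e> i). i \<leftarrow> [5..<n+1]])"

definition g2_bracket :: "complex \<Rightarrow> (nat \<Rightarrow> complex) \<Rightarrow> (nat \<Rightarrow> complex) \<Rightarrow> nat \<Rightarrow> complex" where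
  "g2_bracket b = table_bracket 6 (L4_table 4 @
     [((1, 5), \<e> 1), ((2, 5), 2 \<cdot> \<e> 2), ((3, 5), \<e> 3), ((4, 5), 2 \<cdot> \<e> 4),
      ((5, 1), - \<e> 1), ((5, 3), - \<e> 3), ((5, 4), 2 \<cdot> (\<e> 2 - \<e> 4)),
      ((1, 6), \<e> 1 + b \<cdot> \<e> 3), ((2, 6), (2 * (b + 1)) \<cdot> \<e> 2), ((3, 6), \<e> 1 + b \<cdot> \<e> 3),
      ((4, 6), (b + 1) \<cdot> (\<e> 2 + \<e> 4)),
      ((6, 1), - \<e> 1 - b \<cdot> \<e> 3), ((6, 3), - \<e> 1 - b \<cdot> \<e> 3),
      ((6, 4), (b + 1) \<cdot> (\<e> 2 - \<e> 4))])"

definition g3_bracket :: "complex \<Rightarrow> (nat \<Rightarrow> complex) \<Rightarrow> (nat \<Rightarrow> complex) \<Rightarrow> nat \<Rightarrow> complex" where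
  "g3_bracket c = table_bracket 6 (L4_table 4 @
     [((1, 5), \<e> 1 + (c + 1) \<cdot> \<e> 3), ((2, 5), (2 * (c + 2)) \<cdot> \<e> 2),
      ((3, 5), c \<cdot> \<e> 1 + 2 \<cdot> \<e> 3), ((4, 5), (2 * c + 1) \<cdot> \<e> 2 + 3 \<cdot> \<e> 4),
      ((5, 1), - \<e> 1 - (c + 1) \<cdot> \<e> 3), ((5, 3), (- c) \<cdot> \<e> 1 - 2 \<cdot> \<e> 3),
      ((5, 4), 3 \<cdot> (\<e> 2 - \<e> 4)),
      ((1, 6), \<e> 1), ((2, 6), 2 \<cdot> \<e> 2), ((3, 6), \<e> 3), ((4, 6), 2 \<cdot> \<e> 4),
      ((6, 1), - \<e> 1), ((6, 3), - \<e> 3), ((6, 4), 2 \<cdot> (\<e> 2 - \<e> 4))])"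

definition g4_bracket :: "complex \<Rightarrow> (nat \<Rightarrow> complex) \<Rightarrow> (nat \<Rightarrow> complex) \<Rightarrow> nat \<Rightarrow> complex" where
  "g4_bracket b = table_bracket 6 (L4_table 4 @
     [((1, 5), \<e> 1), ((2, 5), 2 \<cdot> \<e> 2), ((3, 5), \<e> 3), ((4, 5), 2 \<cdot> \<e> 4),
      ((5, 1), - \<e> 1), ((5, 3), - \<e> 3), ((5, 4), 2 \<cdot> (\<e> 2 - \<e> 4)),
      ((1, 6), b \<cdot> \<e> 1 + (1 - b) \<cdot> \<e> 3), ((2, 6), 2 \<cdot> \<e> 2), ((3, 6), \<e> 1),
      ((4, 6), (2 - b) \<cdot> \<e> 2 + b \<cdot> \<e> 4),
      ((6, 1), (- b) \<cdot> \<e> 1 + (b - 1) \<cdot> \<e> 3), ((6, 3), - \<e> 1), ((6, 4), b \<cdot> (\<e> 2 - \<e> 4))])"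


section \<open>The class of algebras and the admissible parameters\<close>

text \<open>Since \<open>dim\<close> is zero for spaces of infinite dimension, the dimension condition includes
  finite-dimensionality.\<close>

definition solvable_ext_of_L4 ::
  "nat \<Rightarrow> (complex \<Rightarrow> 'a \<Rightarrow> 'a) \<Rightarrow> 'a::ab_group_add set \<Rightarrow> ('a \<Rightarrow> 'a \<Rightarrow> 'a) \<Rightarrow> bool" where
  "solvable_ext_of_L4 n scale L br \<longleftrightarrow>
     leibniz_algebra scale L br \<and> vector_space.dim scale L = n + 2 \<and>
     solvable_alg scale L br \<and> indecomposable_alg scale L br \<and>
     (\<exists>N. is_nilradical scale L br N \<and>
          alg_isomorphic scale N br cscale (coords n) (L4_bracket n))"

text \<open>For a bracket on \<open>coords 6\<close> extending that of the four-dimensional nilpotent algebra: no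
  nontrivial linear combination of the right multiplications by \<open>\<e> 5\<close> and \<open>\<e> 6\<close>, restricted to
  \<open>coords 4\<close>, is nilpotent.\<close>

definition nil_independent ::
  "((nat \<Rightarrow> complex) \<Rightarrow> (nat \<Rightarrow> complex) \<Rightarrow> nat \<Rightarrow> complex) \<Rightarrow> bool" where
  "nil_independent br \<longleftrightarrow>
     (\<forall>\<alpha> \<beta>. (\<alpha>, \<beta>) \<noteq> (0, 0) \<longrightarrow>
        \<not> (\<exists>k. \<forall>x \<in> coords 4. ((\<lambda>x. \<alpha> \<cdot> br x (\<e> 5) + \<beta> \<cdot> br x (\<e> 6)) ^^ k) x = 0))"

definition admissible2 :: "complex \<Rightarrow> bool" where
  "admissible2 b \<longleftrightarrow> b \<noteq> -1 \<and> nil_independent (g2_bracket b)"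

definition admissible3 :: "complex \<Rightarrow> bool" where
  "admissible3 c \<longleftrightarrow> c \<noteq> -2 \<and> nil_independent (g3_bracket c)"

definition admissible4 :: "complex \<Rightarrow> bool" where
  "admissible4 b \<longleftrightarrow> b \<noteq> 0 \<and> nil_independent (g4_bracket b)"

end

theory Submission
  imports Defs
begin

text \<open>Write \<open>x = \<e> 1 - \<e> 3\<close> and \<open>y\<^sub>0 = \<e> 3\<close>. In the basis \<open>x, \<e> 2, y\<^sub>0, y\<^sub>1 = \<e> 4 - \<e> 2, y\<^sub>2 = \<e> 5, \<dots>\<close>
  the algebra \<open>\<L>\<^sup>4\<close> is a filiform Lie algebra, \<open>[y\<^sub>i, x] = y\<^sub>i\<^sub>+\<^sub>1 = - [x, y\<^sub>i]\<close>, together with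
  \<open>[y\<^sub>0, y\<^sub>0] = \<e> 2\<close>. All four families become, after a change of basis, one algebra: two further
  basis vectors \<open>T\<close>, \<open>S\<close> act on \<open>x\<close>, \<open>y\<^sub>i\<close>, \<open>\<e> 2\<close> with weights \<open>(1, 0)\<close>, \<open>(i, 1)\<close>, \<open>(0, 2)\<close>.

  Conversely, a derivation of \<open>\<L>\<^sup>4\<close> is triangular with diagonal determined by its weights on \<open>x\<close>
  and \<open>y\<^sub>0\<close>. The right multiplications of an extension \<open>L\<close> thus define a weight map \<open>L \<rightarrow> \<complex>\<^sup>2\<close> that
  vanishes on brackets; an ideal \<open>M \<supseteq> N\<close> of weight zero with \<open>[M, M] \<subseteq> N\<close> is nilpotent, so it equals
  the nilradical \<open>N\<close>. Applied along the derived series this gives \<open>[L, L] \<subseteq> N\<close>, and then that the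
  kernel of the weight map is \<open>N\<close>; as \<open>N\<close> has codimension two, all weights occur. An element \<open>H\<close> of
  weight \<open>(1, \<i>)\<close> acts on \<open>N\<close> with distinct nonzero eigenvalues, and its eigenvectors together
  with the elements \<open>T\<close>, \<open>S\<close> of weight \<open>(1, 0)\<close>, \<open>(0, 1)\<close> with \<open>[T, H] = [S, H] = 0\<close> form the
  required basis.\<close>

section \<open>Coordinate spaces, bilinear brackets and isomorphisms\<close>

lemma cscale_apply [simp]: "(c \<cdot> v) k = c * v k"
  by (simp add: cscale_def)

lemma basis_vec_apply [simp]: "\<e> i k = (if k = i then 1 else 0)"
  by (simp add: basis_vec_def)

interpretation cs: vector_space cscale
  by unfold_locales (auto simp: fun_eq_iff algebra_simps)

lemma sum_fun_apply: "(\<Sum>i\<in>A. f i) k = (\<Sum>i\<in>A. f i k)"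
  by (induct A rule: infinite_finite_induct) auto

lemma subspace_coords: "cs.subspace (coords m)"
  by (auto simp: cs.subspace_def coords_def)

lemma basis_vec_in_coords: "i \<in> {1..m} \<Longrightarrow> \<e> i \<in> coords m"
  by (auto simp: coords_def)

lemma coords_expand: "v \<in> coords m \<Longrightarrow> (\<Sum>i=1..m. v i \<cdot> \<e> i) = v"
  by (rule ext) (auto simp: sum_fun_apply coords_def if_distrib[of "\<lambda>x. _ * x"] cong: if_cong)

lemma coords_mono: "m \<le> m' \<Longrightarrow> coords m \<subseteq> coords m'"
  by (auto simp: coords_def)

lemma dim_coords: "cs.dim (coords m) = m"
proof (rule cs.dim_unique[of "\<e> ` {1..m}"])
  have inj: "inj_on \<e> {1..m}"
    by (rule inj_onI) (metis basis_vec_apply zero_neq_one)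
  show "\<e> ` {1..m} \<subseteq> coords m"
    using basis_vec_in_coords by blast
  show "coords m \<subseteq> cs.span (\<e> ` {1..m})"
  proof
    fix v assume "v \<in> coords m"
    have "(\<Sum>i=1..m. v i \<cdot> \<e> i) \<in> cs.span (\<e> ` {1..m})"
      by (intro cs.span_sum cs.span_scale cs.span_base) auto
    with coords_expand[OF \<open>v \<in> coords m\<close>] show "v \<in> cs.span (\<e> ` {1..m})"
      by simp
  qed
  show "cs.independent (\<e> ` {1..m})"
  proof (rule cs.independent_if_scalars_zero)
    fix f x assume s: "(\<Sum>x\<in>\<e> ` {1..m}. f x \<cdot> x) = 0" and "x \<in> \<e> ` {1..m}"
    then obtain k where k: "k \<in> {1..m}" "x = \<e> k" by blast
    have "(\<Sum>i=1..m. f (\<e> i) \<cdot> \<e> i) k = 0"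
      using s sum.reindex[OF inj, of "\<lambda>x. f x \<cdot> x"] by (simp del: cscale_apply)
    with k show "f x = 0"
      by (simp add: sum_fun_apply if_distrib[of "\<lambda>x. _ * x"] cong: if_cong)
  qed auto
  show "card (\<e> ` {1..m}) = m"
    using card_image[OF inj] by simp
qed

text \<open>Multiplication tables satisfy these axioms by inspection, whereas their Leibniz identity
  is only obtained later, by pulling it back from the standard algebra. Hence the bilinear part of
  \<open>leibniz_algebra\<close> is kept separate.\<close>

locale bilinear_algebra = vector_space scale
  for scale :: "complex \<Rightarrow> 'a::ab_group_add \<Rightarrow> 'a" +
  fixes L :: "'a set" and br :: "'a \<Rightarrow> 'a \<Rightarrow> 'a"
  assumes subspace_carrier: "subspace L"
    and br_closed: "\<lbrakk>x \<in> L; y \<in> L\<rbrakk> \<Longrightarrow> br x y \<in> L"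
    and br_add_left: "\<lbrakk>x \<in> L; y \<in> L; z \<in> L\<rbrakk> \<Longrightarrow> br (x + y) z = br x z + br y z"
    and br_add_right: "\<lbrakk>x \<in> L; y \<in> L; z \<in> L\<rbrakk> \<Longrightarrow> br x (y + z) = br x y + br x z"
    and br_scale_left: "\<lbrakk>x \<in> L; y \<in> L\<rbrakk> \<Longrightarrow> br (scale c x) y = scale c (br x y)"
    and br_scale_right: "\<lbrakk>x \<in> L; y \<in> L\<rbrakk> \<Longrightarrow> br x (scale c y) = scale c (br x y)"
begin

lemma zero_in: "0 \<in> L"
  and add_in: "x \<in> L \<Longrightarrow> y \<in> L \<Longrightarrow> x + y \<in> L"
  and diff_in: "x \<in> L \<Longrightarrow> y \<in> L \<Longrightarrow> x - y \<in> L"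
  and uminus_in: "x \<in> L \<Longrightarrow> - x \<in> L"
  and scale_in: "x \<in> L \<Longrightarrow> scale c x \<in> L"
  and sum_in: "(\<And>i. i \<in> A \<Longrightarrow> f i \<in> L) \<Longrightarrow> sum f A \<in> L"
  using subspace_carrier
  by (auto intro: subspace_0 subspace_add subspace_diff subspace_neg subspace_scale subspace_sum)

lemma br_zero_left [simp]: "y \<in> L \<Longrightarrow> br 0 y = 0"
  using br_scale_left[of 0 y 0] zero_in by simp

lemma br_zero_right [simp]: "x \<in> L \<Longrightarrow> br x 0 = 0"
  using br_scale_right[of x 0 0] zero_in by simp

lemma br_uminus_left: "x \<in> L \<Longrightarrow> y \<in> L \<Longrightarrow> br (- x) y = - br x y"
  using br_scale_left[of x y "-1"] by simp

lemma br_uminus_right: "x \<in> L \<Longrightarrow> y \<in> L \<Longrightarrow> br x (- y) = - br x y"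
  using br_scale_right[of x y "-1"] by simp

lemma br_diff_left: "x \<in> L \<Longrightarrow> y \<in> L \<Longrightarrow> z \<in> L \<Longrightarrow> br (x - y) z = br x z - br y z"
  using br_add_left[of x "- y" z] by (simp add: br_uminus_left uminus_in)

lemma br_sum_left: "(\<And>i. i \<in> A \<Longrightarrow> f i \<in> L) \<Longrightarrow> y \<in> L \<Longrightarrow> br (sum f A) y = (\<Sum>i\<in>A. br (f i) y)"
  by (induct A rule: infinite_finite_induct) (auto simp: br_add_left sum_in)

lemma br_sum_right: "(\<And>i. i \<in> A \<Longrightarrow> f i \<in> L) \<Longrightarrow> y \<in> L \<Longrightarrow> br y (sum f A) = (\<Sum>i\<in>A. br y (f i))"
  by (induct A rule: infinite_finite_induct) (auto simp: br_add_right sum_in)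

lemma br_lincomb:
  assumes "\<And>i. i \<in> A \<Longrightarrow> b i \<in> L"
  shows "br (\<Sum>i\<in>A. scale (u i) (b i)) (\<Sum>j\<in>A. scale (v j) (b j)) =
    (\<Sum>i\<in>A. \<Sum>j\<in>A. scale (u i * v j) (br (b i) (b j)))"
proof -
  have "br (\<Sum>i\<in>A. scale (u i) (b i)) (\<Sum>j\<in>A. scale (v j) (b j)) =
      (\<Sum>i\<in>A. \<Sum>j\<in>A. br (scale (u i) (b i)) (scale (v j) (b j)))"
    using assms by (subst br_sum_left) (simp_all add: br_sum_right scale_in sum_in)
  also have "\<dots> = (\<Sum>i\<in>A. \<Sum>j\<in>A. scale (u i * v j) (br (b i) (b j)))"
    using assms by (intro sum.cong refl) (simp add: br_scale_left br_scale_right scale_in mult.commute)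
  finally show ?thesis .
qed

end

lemma (in leibniz_algebra) bilinear_algebra: "bilinear_algebra scale L br"
  by unfold_locales
    (fact subspace_carrier br_closed br_add_left br_add_right br_scale_left br_scale_right)+

text \<open>If \<open>v j\<close> were nonzero, \<open>b j\<close> would lie in the span of the
  other members, and fewer than \<open>k\<close> vectors would span a space of dimension
  \<open>k\<close>. Using an indexed family instead of a set also rules out repetitions.\<close>

lemma (in vector_space) spanning_family_independent:
  assumes "V \<subseteq> span (b ` {1..k})" and "dim V = k"
    and sum0: "(\<Sum>i=1..k. scale (v i) (b i)) = 0" and j: "j \<in> {1..k}"
  shows "v j = 0"
proof (rule ccontr)
  assume nz: "v j \<noteq> 0"
  let ?S = "b ` ({1..k} - {j})"
  have "scale (v j) (b j) = - (\<Sum>i\<in>{1..k} - {j}. scale (v i) (b i))"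
    using sum0 j sum.remove[of "{1..k}" j "\<lambda>i. scale (v i) (b i)"]
    by (simp add: eq_neg_iff_add_eq_0)
  moreover have "(\<Sum>i\<in>{1..k} - {j}. scale (v i) (b i)) \<in> span ?S"
    by (intro span_sum span_scale span_base) auto
  ultimately have "scale (inverse (v j)) (scale (v j) (b j)) \<in> span ?S"
    by (auto intro!: span_scale span_neg)
  then have "b j \<in> span ?S" using nz by simp
  then have "b ` {1..k} \<subseteq> span ?S" by (auto intro: span_base)
  then have "V \<subseteq> span ?S"
    using assms(1) by (meson order_trans span_minimal subspace_span)
  then have "dim V \<le> card ?S" by (intro dim_le_card) auto
  also have "\<dots> \<le> card ({1..k} - {j})" by (intro card_image_le) auto
  also have "\<dots> < k" using j by simp
  finally show False using assms(2) by simp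
qed

section \<open>Isomorphisms of algebras\<close>

lemma alg_isomorphic_sym:
  assumes iso: "alg_isomorphic scale L br scale' L' br'" and "bilinear_algebra scale L br"
  shows "alg_isomorphic scale' L' br' scale L br"
proof -
  interpret bilinear_algebra scale L br by fact
  from iso obtain f where f: "bij_betw f L L'"
    "\<And>x y. x \<in> L \<Longrightarrow> y \<in> L \<Longrightarrow> f (x + y) = f x + f y"
    "\<And>c x. x \<in> L \<Longrightarrow> f (scale c x) = scale' c (f x)"
    "\<And>x y. x \<in> L \<Longrightarrow> y \<in> L \<Longrightarrow> f (br x y) = br' (f x) (f y)"
    unfolding alg_isomorphic_def by blast
  define g where "g = inv_into L f"
  have g: "g x \<in> L" "f (g x) = x" if "x \<in> L'" for x
    using that f(1) unfolding g_def by (metis bij_betw_def inv_into_into, metis bij_betw_inv_into_right)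
  have gf: "g (f x) = x" if "x \<in> L" for x
    using that f(1) unfolding g_def by (simp add: bij_betw_inv_into_left)
  have "bij_betw g L' L" unfolding g_def by (rule bij_betw_inv_into[OF f(1)])
  moreover have "g (x + y) = g x + g y" if "x \<in> L'" "y \<in> L'" for x y
    using gf[of "g x + g y"] that by (simp add: f g add_in)
  moreover have "g (scale' c x) = scale c (g x)" if "x \<in> L'" for c x
    using gf[of "scale c (g x)"] that by (simp add: f g scale_in)
  moreover have "g (br' x y) = br (g x) (g y)" if "x \<in> L'" "y \<in> L'" for x y
    using gf[of "br (g x) (g y)"] that by (simp add: f g br_closed)
  ultimately show ?thesis unfolding alg_isomorphic_def by blast
qed

lemma alg_isomorphic_trans:
  assumes "alg_isomorphic scale L br scale' L' br'" and "alg_isomorphic scale' L' br' scale'' L'' br''"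
  shows "alg_isomorphic scale L br scale'' L'' br''"
proof -
  from assms(1) obtain f where f: "bij_betw f L L'"
    "\<And>x y. x \<in> L \<Longrightarrow> y \<in> L \<Longrightarrow> f (x + y) = f x + f y"
    "\<And>c x. x \<in> L \<Longrightarrow> f (scale c x) = scale' c (f x)"
    "\<And>x y. x \<in> L \<Longrightarrow> y \<in> L \<Longrightarrow> f (br x y) = br' (f x) (f y)"
    unfolding alg_isomorphic_def by blast
  from assms(2) obtain g where g: "bij_betw g L' L''"
    "\<And>x y. x \<in> L' \<Longrightarrow> y \<in> L' \<Longrightarrow> g (x + y) = g x + g y"
    "\<And>c x. x \<in> L' \<Longrightarrow> g (scale' c x) = scale'' c (g x)"
    "\<And>x y. x \<in> L' \<Longrightarrow> y \<in> L' \<Longrightarrow> g (br' x y) = br'' (g x) (g y)"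
    unfolding alg_isomorphic_def by blast
  have "f x \<in> L'" if "x \<in> L" for x
    using f(1) that by (rule bij_betw_apply)
  then show ?thesis unfolding alg_isomorphic_def
    using bij_betw_trans[OF f(1) g(1)] f(2-) g(2-)
    by (intro exI[of _ "g \<circ> f"]) simp
qed

text \<open>Equal structure constants suffice. The map is built from coordinates to
  \<open>L\<close>, where it is a linear combination of the \<open>b l\<close>, and is inverted at
  the end.\<close>

lemma alg_isomorphic_of_basis:
  assumes L: "bilinear_algebra scale L br" and B: "bilinear_algebra cscale (coords k) B"
    and dim: "vector_space.dim scale L = k"
    and bL: "\<And>i. i \<in> {1..k} \<Longrightarrow> b i \<in> L" and span: "L \<subseteq> module.span scale (b ` {1..k})"
    and hom: "\<And>i j. i \<in> {1..k} \<Longrightarrow> j \<in> {1..k} \<Longrightarrow>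
      br (b i) (b j) = (\<Sum>l=1..k. scale (B (\<e> i) (\<e> j) l) (b l))"
  shows "alg_isomorphic scale L br cscale (coords k) B"
proof -
  interpret bilinear_algebra scale L br by fact
  interpret B: bilinear_algebra cscale "coords k" B by fact
  define \<Phi> where "\<Phi> v = (\<Sum>l=1..k. scale (v l) (b l))" for v
  have add: "\<Phi> (u + v) = \<Phi> u + \<Phi> v" for u v
    by (simp add: \<Phi>_def scale_left_distrib sum.distrib)
  have scl: "\<Phi> (c \<cdot> v) = scale c (\<Phi> v)" for c v
    by (simp add: \<Phi>_def scale_sum_right)
  have sumP: "\<Phi> (sum f A) = (\<Sum>i\<in>A. \<Phi> (f i))" for f :: "nat \<Rightarrow> _" and A
  proof -
    have "\<Phi> 0 = 0" by (simp add: \<Phi>_def)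
    then show ?thesis by (induct A rule: infinite_finite_induct) (simp_all add: add)
  qed
  have bas: "\<Phi> (\<e> i) = b i" if "i \<in> {1..k}" for i
  proof -
    have "\<Phi> (\<e> i) = (\<Sum>l=1..k. if l = i then b i else 0)"
      unfolding \<Phi>_def by (rule sum.cong) auto
    with that show ?thesis by simp
  qed
  have inL: "\<Phi> v \<in> L" for v
    unfolding \<Phi>_def by (intro sum_in scale_in bL)
  have "inj_on \<Phi> (coords k)"
  proof (rule inj_onI)
    fix u v assume uv: "u \<in> coords k" "v \<in> coords k" "\<Phi> u = \<Phi> v"
    have "(\<Sum>l=1..k. scale ((u + (-1) \<cdot> v) l) (b l)) = 0"
      using uv(3) add[of u "(-1) \<cdot> v"] scl[of "-1" v] by (simp add: \<Phi>_def)
    note z = spanning_family_independent[OF span dim this]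
    have "u j = v j" for j
    proof (cases "j \<in> {1..k}")
      case True
      from z[OF this] show ?thesis by simp
    qed (use uv(1,2) in \<open>auto simp: coords_def\<close>)
    then show "u = v" ..
  qed
  moreover have "\<Phi> ` coords k = L"
  proof
    show "\<Phi> ` coords k \<subseteq> L" using inL by blast
    have "subspace (\<Phi> ` coords k)"
    proof (rule subspaceI)
      show "0 \<in> \<Phi> ` coords k"
        by (rule image_eqI[of _ _ 0]) (auto simp: \<Phi>_def coords_def)
    next
      fix x y assume "x \<in> \<Phi> ` coords k" "y \<in> \<Phi> ` coords k"
      then show "x + y \<in> \<Phi> ` coords k"
        by (metis (no_types, lifting) add imageE image_eqI B.add_in)
    next
      fix c x assume "x \<in> \<Phi> ` coords k"
      then show "scale c x \<in> \<Phi> ` coords k"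
        by (metis (no_types, lifting) scl imageE image_eqI B.scale_in)
    qed
    moreover have "b ` {1..k} \<subseteq> \<Phi> ` coords k"
      using bas basis_vec_in_coords by (metis (no_types, lifting) image_eqI image_subsetI)
    ultimately show "L \<subseteq> \<Phi> ` coords k"
      using span span_minimal by blast
  qed
  moreover have "\<Phi> (B u v) = br (\<Phi> u) (\<Phi> v)" if "u \<in> coords k" "v \<in> coords k" for u v
  proof -
    have "B u v = (\<Sum>i=1..k. \<Sum>j=1..k. (u i * v j) \<cdot> B (\<e> i) (\<e> j))"
      using B.br_lincomb[of "{1..k}" \<e> u v] basis_vec_in_coords
      by (simp only: coords_expand[OF that(1)] coords_expand[OF that(2)])
    then have "\<Phi> (B u v) = (\<Sum>i=1..k. \<Sum>j=1..k. scale (u i * v j) (\<Phi> (B (\<e> i) (\<e> j))))"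
      by (simp add: sumP scl)
    also have "\<dots> = (\<Sum>i=1..k. \<Sum>j=1..k. scale (u i * v j) (br (b i) (b j)))"
      by (intro sum.cong refl) (simp add: hom \<Phi>_def)
    also have "\<dots> = br (\<Phi> u) (\<Phi> v)"
      using br_lincomb[of "{1..k}" b u v] bL unfolding \<Phi>_def by simp
    finally show ?thesis .
  qed
  ultimately have "alg_isomorphic cscale (coords k) B scale L br"
    unfolding alg_isomorphic_def bij_betw_def using add scl by (intro exI[of _ \<Phi>]) auto
  then show ?thesis using B by (rule alg_isomorphic_sym)
qed

section \<open>The standard algebra and the multiplication tables\<close>

text \<open>Coordinates refer to the basis x, \<open>\<e> 2\<close>, y_0, y_1, ..., T, S: position 1
  is x, position 3 + i is y_i, and the last two positions are T and S. The chain starts at 3, so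
  coordinate 3 receives nothing from position 2. One closed formula per coordinate reduces
  identities to ring arithmetic.\<close>

definition std_bracket :: "nat \<Rightarrow> (nat \<Rightarrow> complex) \<Rightarrow> (nat \<Rightarrow> complex) \<Rightarrow> nat \<Rightarrow> complex" where
  "std_bracket n u v = (\<lambda>k.
     if k = 1 then u 1 * v (n+1) - u (n+1) * v 1
     else if k = 2 then 2 * u 2 * v (n+2) + u 3 * v 3
     else if k \<in> {3..n} then
       u k * ((of_nat k - 3) * v (n+1) + v (n+2)) - ((of_nat k - 3) * u (n+1) + u (n+2)) * v k +
       (if k = 3 then 0 else u (k-1) * v 1 - u 1 * v (k-1))
     else 0)"

lemma std_bracket_leibniz:
  assumes "n \<ge> 4"
  shows "std_bracket n (std_bracket n x y) z =
    std_bracket n (std_bracket n x z) y + std_bracket n x (std_bracket n y z)"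
proof
  fix k
  \<comment> \<open>At 3 and 4 the indices \<open>k - 1\<close> and \<open>k - 2\<close> leave the
    chain; from 5 on, writing \<open>k = j + 5\<close> removes the truncated subtractions.\<close>
  consider "k = 1" | "k = 2" | "k = 3" | "k = 4" | j where "k = j + 5" "k \<le> n" | "k = 0 \<or> k > n" "k \<noteq> 4"
    by atomize_elim (use assms in presburger)
  then show "std_bracket n (std_bracket n x y) z k =
    (std_bracket n (std_bracket n x z) y + std_bracket n x (std_bracket n y z)) k"
  proof cases
    case 5
    then show ?thesis by (simp add: std_bracket_def algebra_simps)
  qed (use assms in \<open>auto simp: std_bracket_def algebra_simps\<close>)
qed

text \<open>\<open>m = n + 2\<close> gives the whole algebra, \<open>m = n\<close> its
  nilradical.\<close>

lemma bilinear_std_bracket: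
  assumes "n \<ge> 4" "m \<ge> n"
  shows "bilinear_algebra cscale (coords m) (std_bracket n)"
proof
  fix x y :: "nat \<Rightarrow> complex"
  assume "x \<in> coords m" "y \<in> coords m"
  show "std_bracket n x y \<in> coords m"
    using assms by (auto simp: std_bracket_def coords_def)
qed (auto simp: subspace_coords fun_eq_iff algebra_simps std_bracket_def)

text \<open>Distinct keys make the lookup by \<open>map_of\<close> meet each entry exactly once, so
  the double sum over pairs of basis vectors collapses to the entries of the table.\<close>

lemma table_bracket_eq_sum_list:
  assumes "distinct (map fst T)" and "\<And>i j. (i, j) \<in> fst ` set T \<Longrightarrow> i \<in> {1..m} \<and> j \<in> {1..m}"
  shows "table_bracket m T x y k = (\<Sum>((i, j), w) \<leftarrow> T. x i * y j * w k)"
  using assms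
proof (induct T)
  case Nil
  then show ?case by (simp add: table_bracket_def basis_bracket_def sum_fun_apply)
next
  case (Cons t T)
  obtain i0 j0 w where t: "t = ((i0, j0), w)" by (metis prod.collapse)
  have ij: "i0 \<in> {1..m}" "j0 \<in> {1..m}" using Cons.prems(2)[of i0 j0] t by auto
  have none: "map_of T (i0, j0) = None"
    using Cons.prems(1) by (simp add: t map_of_eq_None_iff)
  have "basis_bracket (t # T) i j l =
      basis_bracket T i j l + (if j = j0 then if i = i0 then w l else 0 else 0)" for i j l
    using none by (simp add: t basis_bracket_def)
  then have "table_bracket m (t # T) x y k = table_bracket m T x y k +
      (\<Sum>i=1..m. \<Sum>j=1..m. x i * y j * (if j = j0 then if i = i0 then w k else 0 else 0))"
    by (simp add: table_bracket_def sum_fun_apply algebra_simps sum.distrib)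
  also have "(\<Sum>i=1..m. \<Sum>j=1..m. x i * y j * (if j = j0 then if i = i0 then w k else 0 else 0))
      = x i0 * y j0 * w k"
    using ij by (simp add: if_distrib[of "\<lambda>x. _ * x"] cong: if_cong)
  also have "table_bracket m T x y k = (\<Sum>((i, j), w) \<leftarrow> T. x i * y j * w k)"
    using Cons by auto
  finally show ?case by (simp add: t)
qed

lemma bilinear_table_bracket:
  assumes "\<And>t. t \<in> set T \<Longrightarrow> snd t \<in> coords m"
  shows "bilinear_algebra cscale (coords m) (table_bracket m T)"
proof -
  have "basis_bracket T i j \<in> coords m" for i j
  proof (cases "map_of T (i, j)")
    case (Some w)
    then show ?thesis using assms[OF map_of_SomeD[OF Some]] by (simp add: basis_bracket_def)
  qed (simp add: basis_bracket_def coords_def)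
  then show ?thesis
    by unfold_locales
      (auto simp: table_bracket_def subspace_coords fun_eq_iff sum_fun_apply algebra_simps
          sum.distrib sum_distrib_left intro!: cs.subspace_sum cs.subspace_scale)
qed

section \<open>Coordinate formulas for the tables\<close>

lemma L4_table_distinct: "distinct (map fst (L4_table n))"
  by (auto simp: L4_table_def distinct_map inj_on_def)

lemma sum_list_upt: "(\<Sum>i\<leftarrow>[a..<b]. f i) = (\<Sum>i=a..<b. f i)"
  by (simp add: interv_sum_list_conv_sum_set_nat)

text \<open>The two sums come from the generated rows of the tables, whose values are multiples of
  \<open>\<e> i\<close> and of \<open>\<e> (i + 1)\<close> for \<open>i\<close> in a range.\<close>

lemma sum_delta_upt:
  "(\<Sum>i=a..<b. f i * (if k = i then (1::complex) else 0)) = (if a \<le> k \<and> k < b then f k else 0)"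
  "(\<Sum>i=a..<b. f i * (if k = Suc i then (1::complex) else 0)) = (if a < k \<and> k \<le> b then f (k - 1) else 0)"
  by (simp add: if_distrib[of "\<lambda>x. _ * x"] cong: if_cong)
    (cases k; auto simp: if_distrib[of "\<lambda>x. _ * x"] cong: if_cong)

lemma L4_table_sum:
  assumes "n \<ge> 4"
  shows "(\<Sum>((i, j), w) \<leftarrow> L4_table n. u i * v j * w k) =
    (if k = 2 then u 1 * v 1 + 2 * u 1 * v 3 + u 3 * v 3
     else if k = 4 then u 3 * v 1 - u 1 * v 3
     else if k \<in> {5..n} then u (k-1) * v 1 - u 1 * v (k-1) else 0)"
  using assms
  by (simp add: L4_table_def comp_def sum_list_upt sum_delta_upt sum_negf
      flip: mult.assoc)

lemma L4_bracket_apply: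
  assumes "n \<ge> 4"
  shows "L4_bracket n u v k =
    (if k = 2 then u 1 * v 1 + 2 * u 1 * v 3 + u 3 * v 3
     else if k = 4 then u 3 * v 1 - u 1 * v 3
     else if k \<in> {5..n} then u (k-1) * v 1 - u 1 * v (k-1) else 0)"
  unfolding L4_bracket_def L4_table_sum[OF assms, symmetric]
  using assms by (intro table_bracket_eq_sum_list L4_table_distinct) (auto simp: L4_table_def)

lemma g1_bracket_apply:
  assumes "n \<ge> 4"
  shows "g1_bracket n u v k = L4_bracket n u v k +
    (if k = 1 then u 1 * v (n+1) - u (n+1) * v 1 + u 1 * v (n+2) - u (n+2) * v 1
     else if k = 2 then 4 * u 2 * v (n+1) + u 4 * v (n+1) + 3 * u (n+1) * v 4 + 2 * u 2 * v (n+2)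
       + 2 * u (n+2) * v 4
     else if k = 3 then u 1 * v (n+1) + 2 * u 3 * v (n+1) - u (n+1) * v 1 - 2 * u (n+1) * v 3
       + u 3 * v (n+2) - u (n+2) * v 3
     else if k \<in> {4..n} then (of_nat k - 1) * (u k * v (n+1) - u (n+1) * v k)
       + (of_nat k - 2) * (u k * v (n+2) - u (n+2) * v k)
     else 0)"
  unfolding g1_bracket_def L4_bracket_apply[OF assms] L4_table_sum[OF assms, symmetric]
proof (subst table_bracket_eq_sum_list, goal_cases)
  case 1
  show ?case using assms by (auto simp: L4_table_def distinct_map inj_on_def)
next
  case (2 i j)
  then show ?case using assms by (auto simp: L4_table_def)
next
  case 3
  show ?case
    using assms
    by (simp add: comp_def sum_list_upt sum_delta_upt sum_negf flip: mult.assoc)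
      (auto simp: algebra_simps)
qed

section \<open>Isomorphisms with the standard algebra\<close>

lemma alg_isomorphic_of_maps:
  assumes "\<And>v. v \<in> coords m \<Longrightarrow> f v \<in> coords m" "\<And>v. v \<in> coords m \<Longrightarrow> g v \<in> coords m"
    and "\<And>v. v \<in> coords m \<Longrightarrow> g (f v) = v" "\<And>v. v \<in> coords m \<Longrightarrow> f (g v) = v"
    and "\<And>u v. f (u + v) = f u + f v" "\<And>c v. f (c \<cdot> v) = c \<cdot> f v"
    and "\<And>u v. u \<in> coords m \<Longrightarrow> v \<in> coords m \<Longrightarrow> f (br u v) = B (f u) (f v)"
  shows "alg_isomorphic cscale (coords m) br cscale (coords m) B"
  unfolding alg_isomorphic_def using assms
  by (intro exI[of _ f] conjI bij_betw_byWitness[of _ g]) auto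

text \<open>\<open>f\<close> takes coordinates with respect to \<open>\<e> 1 - \<e> 3\<close>,
  \<open>\<e> 2\<close>, \<open>\<e> 3\<close>, \<open>\<e> 4 - \<e> 2\<close>,
  \<open>\<e> 5\<close>, ...; for instance \<open>\<e> 1\<close> is the first of these plus
  \<open>\<e> 3\<close>, which gives the entry \<open>v 1 + v 3\<close>.\<close>

lemma L4_iso_std:
  assumes "n \<ge> 4"
  shows "alg_isomorphic cscale (coords n) (L4_bracket n) cscale (coords n) (std_bracket n)"
  by (rule alg_isomorphic_of_maps[where
        f = "\<lambda>v. v(2 := v 2 + v 4, 3 := v 1 + v 3)" and g = "\<lambda>v. v(2 := v 2 - v 4, 3 := v 3 - v 1)"])
    (use assms in \<open>auto simp: coords_def fun_eq_iff algebra_simps L4_bracket_apply std_bracket_def\<close>)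

text \<open>On \<open>\<e> 1 - \<e> 3\<close> and \<open>\<e> 3\<close>, right multiplication by
  \<open>\<e> (n+1)\<close> has weights 1 and 2, and right multiplication by
  \<open>\<e> (n+2)\<close> has weights 1 and 1. Hence these elements correspond to T + 2S and T +
  S.\<close>

lemma g1_iso_std:
  assumes "n \<ge> 4"
  shows "alg_isomorphic cscale (coords (n+2)) (g1_bracket n) cscale (coords (n+2)) (std_bracket n)"
  by (rule alg_isomorphic_of_maps[where
        f = "\<lambda>v. v(2 := v 2 + v 4, 3 := v 1 + v 3, n+1 := v (n+1) + v (n+2), n+2 := 2 * v (n+1) + v (n+2))" and
        g = "\<lambda>v. v(2 := v 2 - v 4, 3 := v 3 - v 1, n+1 := v (n+2) - v (n+1), n+2 := 2 * v (n+1) - v (n+2))"])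
    (use assms in \<open>auto simp: coords_def fun_eq_iff algebra_simps g1_bracket_apply L4_bracket_apply std_bracket_def\<close>)


lemma g2_bracket_apply:
  "g2_bracket b u v k =
    (if k = 1 then u 1 * v 5 - u 5 * v 1 + (u 1 + u 3) * v 6 - u 6 * (v 1 + v 3)
     else if k = 2 then (u 1 * v 1 + 2 * u 1 * v 3 + u 3 * v 3) + 2 * u 2 * v 5 + 2 * u 5 * v 4
       + (b + 1) * (2 * u 2 * v 6 + u 4 * v 6 + u 6 * v 4)
     else if k = 3 then u 3 * v 5 - u 5 * v 3 + b * ((u 1 + u 3) * v 6 - u 6 * (v 1 + v 3))
     else if k = 4 then u 3 * v 1 - u 1 * v 3 + 2 * u 4 * v 5 - 2 * u 5 * v 4
       + (b + 1) * (u 4 * v 6 - u 6 * v 4)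
     else 0)"
  unfolding g2_bracket_def
  by (subst table_bracket_eq_sum_list) (auto simp: L4_table_def algebra_simps)

text \<open>Right multiplication by \<open>\<e> 6\<close> has eigenvalue 0 on
  \<open>\<e> 1 - \<e> 3\<close> and \<open>b + 1\<close> on
  \<open>\<e> 1 + b \<cdot> \<e> 3\<close>; these are independent since
  \<open>b \<noteq> -1\<close>. The second vector, divided by \<open>b + 1\<close> so that its
  square is \<open>\<e> 2\<close>, serves as y_0. The elements \<open>\<e> 5\<close> and
  \<open>\<e> 6\<close> become T + S and (b + 1)S.\<close>

lemma g2_iso_std:
  assumes "b \<noteq> -1"
  shows "alg_isomorphic cscale (coords 6) (g2_bracket b) cscale (coords 6) (std_bracket 4)"
proof -
  \<comment> \<open>The inverse enters only through the polynomial equation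
    \<open>d * e = 1\<close>, which the method \<open>algebra\<close> can use.\<close>
  define d e where "d = b + 1" and "e = 1 / d"
  have "d \<noteq> 0" using assms by (simp add: d_def eq_neg_iff_add_eq_0)
  then have de: "d * e = 1" by (simp add: e_def)
  define f g :: "(nat \<Rightarrow> complex) \<Rightarrow> nat \<Rightarrow> complex"
    where "f v = v(1 := v 1 - e * (v 1 + v 3), 2 := v 2 + v 4, 3 := v 1 + v 3, 6 := v 5 + (b + 1) * v 6)"
      and "g v = v(1 := v 1 + e * v 3, 2 := v 2 - v 4, 3 := v 3 - (v 1 + e * v 3), 6 := e * (v 6 - v 5))" for v
  show ?thesis
  proof (rule alg_isomorphic_of_maps[of 6 f g])
    fix u v :: "nat \<Rightarrow> complex"
    show "v \<in> coords 6 \<Longrightarrow> f v \<in> coords 6" "v \<in> coords 6 \<Longrightarrow> g v \<in> coords 6"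
      by (auto simp: f_def g_def coords_def)
    show "g (f v) = v" "f (g v) = v"
      using de d_def by (auto simp: f_def g_def fun_eq_iff) algebra+
    show "f (u + v) = f u + f v" "f (c \<cdot> v) = c \<cdot> f v" for c
      by (auto simp: f_def fun_eq_iff algebra_simps)
    show "f (g2_bracket b u v) = std_bracket 4 (f u) (f v)"
    proof
      fix k :: nat
      consider "k = 1" | "k = 2" | "k = 3" | "k = 4" | "k \<notin> {1..4}"
        by atomize_elim (simp, linarith)
      then show "f (g2_bracket b u v) k = std_bracket 4 (f u) (f v) k"
      proof cases
        case 1
        have "f (g2_bracket b u v) 1 = f u 1 * f v 5 - f u 5 * f v 1"
          using de unfolding d_def by (simp add: f_def g2_bracket_apply) algebra
        with 1 show ?thesis by (simp add: std_bracket_def)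
      qed (auto simp: f_def g2_bracket_apply std_bracket_def algebra_simps)
    qed
  qed
qed

lemma g3_bracket_apply:
  "g3_bracket c u v k =
    (if k = 1 then (u 1 + c * u 3) * v 5 - u 5 * (v 1 + c * v 3) + u 1 * v 6 - u 6 * v 1
     else if k = 2 then (u 1 * v 1 + 2 * u 1 * v 3 + u 3 * v 3) + 2 * (c + 2) * u 2 * v 5
       + (2 * c + 1) * u 4 * v 5 + 3 * u 5 * v 4 + 2 * u 2 * v 6 + 2 * u 6 * v 4
     else if k = 3 then ((c + 1) * u 1 + 2 * u 3) * v 5 - u 5 * ((c + 1) * v 1 + 2 * v 3)
       + u 3 * v 6 - u 6 * v 3
     else if k = 4 then u 3 * v 1 - u 1 * v 3 + 3 * (u 4 * v 5 - u 5 * v 4)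
       + 2 * (u 4 * v 6 - u 6 * v 4)
     else 0)"
  unfolding g3_bracket_def
  by (subst table_bracket_eq_sum_list) (auto simp: L4_table_def algebra_simps)

text \<open>Right multiplication by \<open>\<e> 5\<close> has eigenvalue \<open>1 - c\<close> on
  \<open>\<e> 1 - \<e> 3\<close> and \<open>c + 2\<close> on
  \<open>c \<cdot> \<e> 1 + (c + 1) \<cdot> \<e> 3\<close>. So \<open>\<e> 5\<close> becomes (1 -
  c)T + (c + 2)S and \<open>\<e> 6\<close> becomes T + S; the determinant is -(2c + 1).\<close>

lemma g3_iso_std:
  assumes "2 * c + 1 \<noteq> 0"
  shows "alg_isomorphic cscale (coords 6) (g3_bracket c) cscale (coords 6) (std_bracket 4)"
proof -
  define d e where "d = 2 * c + 1" and "e = 1 / d"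
  have "d \<noteq> 0" using assms by (simp add: d_def)
  then have de: "d * e = 1" by (simp add: e_def)
  define f g :: "(nat \<Rightarrow> complex) \<Rightarrow> nat \<Rightarrow> complex"
    where "f v = v(1 := v 1 - c * e * (v 1 + v 3), 2 := v 2 + v 4, 3 := v 1 + v 3,
      5 := (1 - c) * v 5 + v 6, 6 := (c + 2) * v 5 + v 6)"
      and "g v = v(1 := v 1 + c * e * v 3, 2 := v 2 - v 4, 3 := v 3 - (v 1 + c * e * v 3),
      5 := e * (v 6 - v 5), 6 := v 5 - (1 - c) * e * (v 6 - v 5))" for v
  show ?thesis
  proof (rule alg_isomorphic_of_maps[of 6 f g])
    fix u v :: "nat \<Rightarrow> complex"
    show "v \<in> coords 6 \<Longrightarrow> f v \<in> coords 6" "v \<in> coords 6 \<Longrightarrow> g v \<in> coords 6"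
      by (auto simp: f_def g_def coords_def)
    show "g (f v) = v" "f (g v) = v"
      using de d_def by (auto simp: f_def g_def fun_eq_iff) algebra+
    show "f (u + v) = f u + f v" "f (c \<cdot> v) = c \<cdot> f v" for c
      by (auto simp: f_def fun_eq_iff algebra_simps)
    show "f (g3_bracket c u v) = std_bracket 4 (f u) (f v)"
    proof
      fix k :: nat
      consider "k = 1" | "k = 2" | "k = 3" | "k = 4" | "k \<notin> {1..4}"
        by atomize_elim (simp, linarith)
      then show "f (g3_bracket c u v) k = std_bracket 4 (f u) (f v) k"
      proof cases
        case 1
        have "f (g3_bracket c u v) 1 = f u 1 * f v 5 - f u 5 * f v 1"
          using de unfolding d_def by (simp add: f_def g3_bracket_apply) algebra
        with 1 show ?thesis by (simp add: std_bracket_def)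
      qed (auto simp: f_def g3_bracket_apply std_bracket_def algebra_simps)
    qed
  qed
qed

lemma g4_bracket_apply:
  "g4_bracket b u v k =
    (if k = 1 then u 1 * v 5 - u 5 * v 1 + (b * u 1 + u 3) * v 6 - u 6 * (b * v 1 + v 3)
     else if k = 2 then (u 1 * v 1 + 2 * u 1 * v 3 + u 3 * v 3) + 2 * u 2 * v 5
       + 2 * u 5 * v 4 + 2 * u 2 * v 6 + (2 - b) * u 4 * v 6 + b * u 6 * v 4
     else if k = 3 then u 3 * v 5 - u 5 * v 3 + (1 - b) * (u 1 * v 6 - u 6 * v 1)
     else if k = 4 then u 3 * v 1 - u 1 * v 3 + 2 * (u 4 * v 5 - u 5 * v 4)
       + b * (u 4 * v 6 - u 6 * v 4)
     else 0)"
  unfolding g4_bracket_def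
  by (subst table_bracket_eq_sum_list) (auto simp: L4_table_def algebra_simps)

text \<open>Right multiplication by \<open>\<e> 6\<close> has eigenvalue \<open>b - 1\<close> on
  \<open>\<e> 1 - \<e> 3\<close> and 1 on \<open>\<e> 1 + (1 - b) \<cdot> \<e> 3\<close>. So
  \<open>\<e> 5\<close> becomes T + S and \<open>\<e> 6\<close> becomes (b - 1)T + S; they differ by
  (2 - b)T.\<close>

lemma g4_iso_std:
  assumes "b \<noteq> 2"
  shows "alg_isomorphic cscale (coords 6) (g4_bracket b) cscale (coords 6) (std_bracket 4)"
proof -
  define d e where "d = 2 - b" and "e = 1 / d"
  have "d \<noteq> 0" using assms by (simp add: d_def)
  then have de: "d * e = 1" by (simp add: e_def)
  define f g :: "(nat \<Rightarrow> complex) \<Rightarrow> nat \<Rightarrow> complex"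
    where "f v = v(1 := v 1 - e * (v 1 + v 3), 2 := v 2 + v 4, 3 := v 1 + v 3,
      5 := v 5 + (b - 1) * v 6, 6 := v 5 + v 6)"
      and "g v = v(1 := v 1 + e * v 3, 2 := v 2 - v 4, 3 := v 3 - (v 1 + e * v 3),
      5 := v 6 - e * (v 6 - v 5), 6 := e * (v 6 - v 5))" for v
  show ?thesis
  proof (rule alg_isomorphic_of_maps[of 6 f g])
    fix u v :: "nat \<Rightarrow> complex"
    show "v \<in> coords 6 \<Longrightarrow> f v \<in> coords 6" "v \<in> coords 6 \<Longrightarrow> g v \<in> coords 6"
      by (auto simp: f_def g_def coords_def)
    show "g (f v) = v" "f (g v) = v"
      using de d_def by (auto simp: f_def g_def fun_eq_iff) algebra+
    show "f (u + v) = f u + f v" "f (c \<cdot> v) = c \<cdot> f v" for c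
      by (auto simp: f_def fun_eq_iff algebra_simps)
    show "f (g4_bracket b u v) = std_bracket 4 (f u) (f v)"
    proof
      fix k :: nat
      consider "k = 1" | "k = 2" | "k = 3" | "k = 4" | "k \<notin> {1..4}"
        by atomize_elim (simp, linarith)
      then show "f (g4_bracket b u v) k = std_bracket 4 (f u) (f v) k"
      proof cases
        case 1
        have "f (g4_bracket b u v) 1 = f u 1 * f v 5 - f u 5 * f v 1"
          using de unfolding d_def by (simp add: f_def g4_bracket_apply) algebra
        with 1 show ?thesis by (simp add: std_bracket_def)
      qed (auto simp: f_def g4_bracket_apply std_bracket_def algebra_simps)
    qed
  qed
qed

section \<open>The standard algebra is a solvable extension\<close>

lemma (in bilinear_algebra) bracket_span_subset:
  assumes "subspace W" and "\<And>a b. a \<in> A \<Longrightarrow> b \<in> B \<Longrightarrow> br a b \<in> W"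
  shows "bracket_span scale br A B \<subseteq> W"
  unfolding bracket_span_def using assms by (intro span_minimal) auto

lemma (in bilinear_algebra) bracket_span_eq_0:
  assumes "\<And>a b. a \<in> A \<Longrightarrow> b \<in> B \<Longrightarrow> br a b = 0"
  shows "bracket_span scale br A B = {0}"
  using bracket_span_subset[of "{0}" A B] assms span_zero unfolding bracket_span_def by auto

lemma bilinear_L4_bracket:
  assumes "n \<ge> 4"
  shows "bilinear_algebra cscale (coords n) (L4_bracket n)"
proof
  fix x y :: "nat \<Rightarrow> complex"
  assume "x \<in> coords n" "y \<in> coords n"
  show "L4_bracket n x y \<in> coords n"
    using assms by (auto simp: L4_bracket_apply coords_def)
qed (use assms in \<open>auto simp: subspace_coords fun_eq_iff algebra_simps L4_bracket_apply\<close>)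

text \<open>The isomorphism \<open>\<phi>\<close> is a parameter: solvability, nilradical and
  indecomposability are then proved in \<open>L\<close> itself through coordinates, instead of being
  transported from the standard algebra one by one.\<close>

locale standard_algebra = bilinear_algebra scale L br
  for scale :: "complex \<Rightarrow> 'a::ab_group_add \<Rightarrow> 'a" and L br +
  fixes n :: nat and \<phi> :: "'a \<Rightarrow> nat \<Rightarrow> complex"
  assumes n: "n \<ge> 4" and dim: "dim L = n + 2"
    and bij: "bij_betw \<phi> L (coords (n + 2))"
    and add: "\<And>x y. x \<in> L \<Longrightarrow> y \<in> L \<Longrightarrow> \<phi> (x + y) = \<phi> x + \<phi> y"
    and scl: "\<And>c x. x \<in> L \<Longrightarrow> \<phi> (scale c x) = c \<cdot> \<phi> x"
    and hom: "\<And>x y. x \<in> L \<Longrightarrow> y \<in> L \<Longrightarrow> \<phi> (br x y) = std_bracket n (\<phi> x) (\<phi> y)"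
begin

definition E :: "nat \<Rightarrow> 'a" where "E i = inv_into L \<phi> (\<e> i)"

definition vanishing :: "nat set \<Rightarrow> 'a set" where
  "vanishing S = {x \<in> L. \<forall>k \<in> S. \<phi> x k = 0}"

abbreviation N :: "'a set" where "N \<equiv> vanishing {n + 1, n + 2}"

lemma phi_zero [simp]: "\<phi> 0 = 0"
  using scl[OF zero_in, of 0] by (simp add: fun_eq_iff)

lemma phi_diff: "x \<in> L \<Longrightarrow> y \<in> L \<Longrightarrow> \<phi> (x - y) = \<phi> x - \<phi> y"
  using add[of "x - y" y] diff_in[of x y] by (simp add: algebra_simps)

lemma phi_outside: "x \<in> L \<Longrightarrow> k \<notin> {1..n+2} \<Longrightarrow> \<phi> x k = 0"
  using bij_betw_apply[OF bij, of x] by (auto simp: coords_def)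

lemma phi_inject: "x \<in> L \<Longrightarrow> y \<in> L \<Longrightarrow> \<phi> x = \<phi> y \<Longrightarrow> x = y"
  using bij by (metis bij_betw_def inj_on_def)

lemma E: "i \<in> {1..n+2} \<Longrightarrow> E i \<in> L" "i \<in> {1..n+2} \<Longrightarrow> \<phi> (E i) = \<e> i"
  unfolding E_def using bij basis_vec_in_coords[of i "n+2"]
  by (auto simp: bij_betw_def inv_into_into f_inv_into_f simp del: One_nat_def)

lemma subspace_vanishing: "subspace (vanishing S)"
  by (auto simp: subspace_def vanishing_def add scl zero_in add_in scale_in)

lemma vanishingD: "x \<in> vanishing S \<Longrightarrow> k \<in> S \<Longrightarrow> \<phi> x k = 0" "x \<in> vanishing S \<Longrightarrow> x \<in> L"
  by (auto simp: vanishing_def)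

lemma br_in_N: "x \<in> L \<Longrightarrow> y \<in> L \<Longrightarrow> br x y \<in> N"
  using n by (simp add: vanishing_def br_closed hom std_bracket_def)

section \<open>Solvability and nilradical of the standard algebra\<close>

lemma leibniz_algebra: "leibniz_algebra scale L br"
proof unfold_locales
  fix x y z assume "x \<in> L" "y \<in> L" "z \<in> L"
  then show "br (br x y) z = br (br x z) y + br x (br y z)"
    by (intro phi_inject)
      (simp_all add: br_closed add_in add hom, rule std_bracket_leibniz[OF n])
qed (fact subspace_carrier br_closed br_add_left br_add_right br_scale_left br_scale_right)+

lemma solvable: "solvable_alg scale L br"
  unfolding solvable_alg_def
proof (rule exI)
  \<comment> \<open>Only the coordinates 2 and 4, ..., n survive in [N, N]; the vectors supported
    there have zero brackets with one another.\<close>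
  let ?W = "vanishing {1, 3, n + 1, n + 2}"
  have 1: "derived_series scale br L (Suc 0) \<subseteq> N"
    unfolding derived_series.simps
    by (intro bracket_span_subset subspace_vanishing br_in_N)
  have "br x y \<in> ?W" if "x \<in> N" "y \<in> N" for x y
    using that n by (simp add: vanishing_def br_closed hom std_bracket_def)
  with 1 have 2: "derived_series scale br L (Suc (Suc 0)) \<subseteq> ?W"
    unfolding derived_series.simps(2)[of scale br L "Suc 0"]
    by (intro bracket_span_subset subspace_vanishing) blast
  have "br x y = 0" if "x \<in> ?W" "y \<in> ?W" for x y
    using that
    by (intro phi_inject) (auto simp: vanishing_def br_closed hom zero_in fun_eq_iff std_bracket_def)
  with 2 show "derived_series scale br L (Suc (Suc (Suc 0))) = {0}"
    unfolding derived_series.simps(2)[of scale br L "Suc (Suc 0)"]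
    by (intro bracket_span_eq_0) blast
qed

lemma ideal_N: "two_sided_ideal scale L br N"
  unfolding two_sided_ideal_def using subspace_vanishing br_in_N vanishingD(2) by blast

lemma nilpotent_N: "nilpotent_alg scale N br"
  unfolding nilpotent_alg_def
proof (rule exI)
  \<comment> \<open>Right multiplication by \<open>N\<close> moves the chain one place up, so one
    more coordinate dies at each step. Coordinate 2 stays free until \<open>W (n - 3)\<close>, which
    consists of multiples of \<open>E 2\<close> and is annihilated by \<open>N\<close> on the
    right.\<close>
  define W where "W k = vanishing ({1, 3, n + 1, n + 2} \<union> {4..<k+4})" for k
  have "lower_series scale br N (Suc k) \<subseteq> W k" for k
  proof (induct k)
    case 0
    have "br x y \<in> W 0" if "x \<in> N" "y \<in> N" for x y
      using that n by (simp add: W_def vanishing_def br_closed hom std_bracket_def)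
    then show ?case by (simp add: bracket_span_subset W_def subspace_vanishing)
  next
    case (Suc k)
    have "br x y \<in> W (Suc k)" if "x \<in> W k" "y \<in> N" for x y
    proof -
      have x: "\<phi> x j = 0" if "j \<in> {1, 3, n + 1, n + 2} \<union> {4..<k+4}" for j
        using \<open>x \<in> W k\<close> that unfolding W_def by (rule vanishingD(1))
      have "\<phi> y (n + 1) = 0" "\<phi> y (n + 2) = 0" using that by (auto simp: vanishing_def)
      moreover have "\<phi> x (j - 1) = 0" if "4 \<le> j" "j < k + 5" for j
        using that by (intro x) auto
      ultimately have "std_bracket n (\<phi> x) (\<phi> y) j = 0"
        if "j \<in> {1, 3, n + 1, n + 2} \<union> {4..<Suc k+4}" for j
        using that x[of 1] x[of 3] x[of "n+1"] x[of "n+2"] by (auto simp: std_bracket_def)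
      then show ?thesis
        using that by (auto simp: W_def vanishing_def br_closed hom)
    qed
    with Suc show ?case
      unfolding lower_series.simps(2)[of scale br N "Suc k"]
      by (intro bracket_span_subset) (auto simp: W_def subspace_vanishing)
  qed
  moreover have "br x y = 0" if "x \<in> W (n - 3)" "y \<in> N" for x y
  proof (rule phi_inject)
    have x: "\<phi> x j = 0" if "j \<noteq> 2" for j
    proof (cases "j \<in> {1, 3, n + 1, n + 2} \<union> {4..<n+1}")
      case True
      with \<open>x \<in> W (n - 3)\<close> n show ?thesis by (intro vanishingD(1)) (auto simp: W_def)
    next
      case False
      with that \<open>x \<in> W (n - 3)\<close> n show ?thesis
        by (intro phi_outside) (auto simp: W_def vanishing_def)
    qed
    have "x \<in> L" "y \<in> L" "\<phi> y (n + 2) = 0"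
      using that by (auto simp: W_def vanishing_def)
    with x n show "\<phi> (br x y) = \<phi> 0"
      by (auto simp: hom std_bracket_def fun_eq_iff)
  qed (use that in \<open>auto simp: W_def vanishing_def br_closed zero_in\<close>)
  ultimately show "lower_series scale br N (Suc (Suc (n - 3))) = {0}"
    unfolding lower_series.simps(2)[of scale br N "Suc (n - 3)"]
    by (intro bracket_span_eq_0) blast
qed

text \<open>On vectors without T-coordinate, right multiplication by \<open>u\<close> multiplies
  coordinate 1 by the T-coordinate of \<open>u\<close>. If that is nonzero, iterated brackets with
  \<open>u\<close> never vanish, against nilpotency. Coordinate 3 plays the same role for S.\<close>

lemma nilpotent_ideal_subset_N:
  assumes M: "two_sided_ideal scale L br M" and nil: "nilpotent_alg scale M br"
  shows "M \<subseteq> N"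
proof
  fix u assume u: "u \<in> M"
  have subM: "M \<subseteq> L" using M by (simp add: two_sided_ideal_def)
  have uL: "u \<in> L" using u subM by blast
  have Mr: "br x y \<in> M" if "x \<in> L" "y \<in> M" for x y
    using M that by (simp add: two_sided_ideal_def)
  have step: "br w u \<in> lower_series scale br M (Suc k)" if "w \<in> lower_series scale br M k" for w k
    using that u by (auto simp: bracket_span_def intro: span_base)
  have "\<phi> u (n + 1) = 0"
  proof (rule ccontr)
    assume p: "\<phi> u (n + 1) \<noteq> 0"
    have "\<exists>w \<in> lower_series scale br M k. w \<in> L \<and> \<phi> w 1 \<noteq> 0 \<and> \<phi> w (n + 1) = 0" for k
    proof (induct k)
      case 0
      \<comment> \<open>The iteration is seeded with this bracket because it lies in the ideal
        \<open>M\<close>, while \<open>E 1\<close> may not.\<close>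
      have "br (E 1) u \<in> M" by (simp add: Mr E u)
      with subM p n show ?case
        by (intro bexI[of _ "br (E 1) u"]) (auto simp: hom E uL std_bracket_def)
    next
      case (Suc k)
      then obtain w where w: "w \<in> lower_series scale br M k" "w \<in> L" "\<phi> w 1 \<noteq> 0" "\<phi> w (n + 1) = 0"
        by blast
      show ?case
        by (rule bexI[OF _ step[OF w(1)]])
          (use w p n in \<open>auto simp: hom uL br_closed std_bracket_def\<close>)
    qed
    moreover obtain k where "lower_series scale br M k = {0}"
      using nil by (auto simp: nilpotent_alg_def)
    ultimately show False by (metis phi_zero singletonD zero_fun_apply)
  qed
  moreover have "\<phi> u (n + 2) = 0"
  proof (rule ccontr)
    assume p: "\<phi> u (n + 2) \<noteq> 0"
    have "\<exists>w \<in> lower_series scale br M k. w \<in> L \<and> \<phi> w 3 \<noteq> 0 \<and> \<phi> w (n + 2) = 0" for k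
    proof (induct k)
      case 0
      have "br (E 3) u \<in> M" using n by (simp add: Mr E u)
      with subM p n show ?case
        by (intro bexI[of _ "br (E 3) u"]) (auto simp: hom E uL std_bracket_def)
    next
      case (Suc k)
      then obtain w where w: "w \<in> lower_series scale br M k" "w \<in> L" "\<phi> w 3 \<noteq> 0" "\<phi> w (n + 2) = 0"
        by blast
      show ?case
        by (rule bexI[OF _ step[OF w(1)]])
          (use w p n in \<open>auto simp: hom uL br_closed std_bracket_def\<close>)
    qed
    moreover obtain k where "lower_series scale br M k = {0}"
      using nil by (auto simp: nilpotent_alg_def)
    ultimately show False by (metis phi_zero singletonD zero_fun_apply)
  qed
  ultimately show "u \<in> N" using uL by (simp add: vanishing_def)
qed

lemma nilradical_N: "is_nilradical scale L br N"
  unfolding is_nilradical_def maximal_nilpotent_ideal_def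
  using ideal_N nilpotent_N nilpotent_ideal_subset_N by blast

lemma N_iso_L4: "alg_isomorphic scale N br cscale (coords n) (L4_bracket n)"
proof -
  have "bij_betw \<phi> N (coords n)"
  proof (rule bij_betw_subset[OF bij])
    show "N \<subseteq> L" by (auto simp: vanishing_def)
    show "\<phi> ` N = coords n"
    proof
      have "\<phi> x k = 0" if "x \<in> N" "k \<notin> {1..n}" for x k
        using that phi_outside[of x k] by (cases "k \<in> {n+1, n+2}") (auto simp: vanishing_def)
      then show "\<phi> ` N \<subseteq> coords n" by (auto simp: coords_def)
      show "coords n \<subseteq> \<phi> ` N"
      proof
        fix v assume v: "v \<in> coords n"
        then have "v \<in> \<phi> ` L"
          using bij coords_mono[of n "n+2"] by (auto simp: bij_betw_def)
        then obtain x where "x \<in> L" "v = \<phi> x" by blast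
        with v show "v \<in> \<phi> ` N" by (auto simp: vanishing_def coords_def)
      qed
    qed
  qed
  then have "alg_isomorphic scale N br cscale (coords n) (std_bracket n)"
    unfolding alg_isomorphic_def using add scl hom
    by (intro exI[of _ \<phi>]) (simp add: vanishing_def)
  then show ?thesis
    using alg_isomorphic_sym[OF L4_iso_std[OF n] bilinear_L4_bracket[OF n]]
    by (rule alg_isomorphic_trans)
qed

text \<open>This shows that two ideals outside \<open>N\<close> always meet, so they cannot be the
  summands of a decomposition. If the T-coordinate of some \<open>u\<close> in \<open>I\<close> is
  zero and its S-coordinate is not, [E n, u] is already a nonzero multiple of
  \<open>E n\<close>.\<close>

lemma E_n_in_ideal:
  assumes I: "two_sided_ideal scale L br I" and "\<not> I \<subseteq> N"
  shows "E n \<in> I"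
proof -
  have subI: "subspace I" and IL: "I \<subseteq> L"
    and Ir: "\<And>x y. x \<in> L \<Longrightarrow> y \<in> I \<Longrightarrow> br x y \<in> I"
    using I by (auto simp: two_sided_ideal_def)
  obtain u where u: "u \<in> I" "u \<in> L" "\<phi> u (n+1) \<noteq> 0 \<or> \<phi> u (n+2) \<noteq> 0"
    using assms(2) IL by (auto simp: vanishing_def)
  have "\<exists>w \<in> I. \<exists>c. c \<noteq> 0 \<and> w = scale c (E n)"
  proof (cases "\<phi> u (n+1) = 0")
    case True
    show ?thesis
    proof (intro bexI[of _ "br (E n) u"] exI conjI)
      show "br (E n) u = scale (\<phi> u (n+2)) (E n)"
        using True n u by (intro phi_inject)
          (auto simp: E br_closed scale_in hom scl std_bracket_def fun_eq_iff)
    qed (use u True n in \<open>auto intro!: Ir E\<close>)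
  next
    case False
    \<comment> \<open>This element of \<open>I\<close> has a nonzero x-coordinate and no y_0-, T- or
      S-coordinate, so bracketing \<open>E (n-1)\<close> with it shifts the chain once and yields a
      multiple of \<open>E n\<close>, without an \<open>E 2\<close> term even when
      \<open>n - 1 = 3\<close>.\<close>
    define v where "v = br (E 1) u"
    have v: "v \<in> I" "v \<in> L" using u n by (auto simp: v_def Ir E br_closed)
    have phiv: "\<phi> v 1 = \<phi> u (n+1)" "\<phi> v 3 = 0" "\<phi> v (n+1) = 0" "\<phi> v (n+2) = 0"
      using u n by (auto simp: v_def hom E std_bracket_def)
    have E': "E (n-1) \<in> L" "\<phi> (E (n-1)) = \<e> (n-1)" using n by (auto intro!: E)
    show ?thesis
    proof (intro bexI[of _ "br (E (n-1)) v"] exI conjI)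
      show "br (E (n-1)) v = scale (\<phi> u (n+1)) (E n)"
        using phiv n v E' by (intro phi_inject)
          (auto simp: E br_closed scale_in hom scl std_bracket_def fun_eq_iff)
    qed (use v False E' in \<open>auto intro!: Ir\<close>)
  qed
  then obtain c where "c \<noteq> 0" "scale c (E n) \<in> I" by blast
  then have "scale (1 / c) (scale c (E n)) \<in> I" using subI subspace_scale by blast
  with \<open>c \<noteq> 0\<close> show ?thesis by simp
qed

text \<open>Since S has weight 1 on every y_i, [E k, v] is \<open>E k\<close> up to later chain
  members and \<open>E 2\<close>. The vector \<open>E 2\<close> itself comes from [E 2, v], and
  \<open>E 1\<close> from [E 1, u] modulo the rest.\<close>

lemma N_subset_ideal:
  assumes I: "two_sided_ideal scale L br I"
    and u: "u \<in> I" "\<phi> u (n+1) = 1" "\<phi> u (n+2) = 0"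
    and v: "v \<in> I" "\<phi> v (n+1) = 0" "\<phi> v (n+2) = 1"
  shows "N \<subseteq> I"
proof -
  have subI: "subspace I" and IL: "I \<subseteq> L"
    and Ir: "\<And>x y. x \<in> L \<Longrightarrow> y \<in> I \<Longrightarrow> br x y \<in> I"
    using I by (auto simp: two_sided_ideal_def)
  have uvL: "u \<in> L" "v \<in> L" using u v IL by auto
  have reduce: "x \<in> I" if "x - scale c y \<in> I" "y \<in> I" for x y c
    using subspace_add[OF subI that(1) subspace_scale[OF subI that(2), of c]] by simp
  have E2: "E 2 \<in> I"
  proof -
    have "br (E 2) v = scale 2 (E 2)"
      using uvL v n by (intro phi_inject)
        (auto simp: E br_closed scale_in hom scl std_bracket_def fun_eq_iff)
    moreover have "br (E 2) v \<in> I" by (intro Ir E v) auto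
    ultimately have "scale 2 (E 2) \<in> I" by simp
    from subspace_scale[OF subI this, of "1/2"] show ?thesis by simp
  qed
  \<comment> \<open>The subspace is spanned by \<open>E 2\<close> and \<open>E k\<close>, ...,
    \<open>E n\<close>; the induction runs downwards from \<open>k = n + 1\<close>, removing the
    leading coordinate with [E k, v].\<close>
  have "\<forall>x \<in> vanishing ({1, n+1, n+2} \<union> {3..<k}). x \<in> I" if "3 \<le> k" "k \<le> n + 1" for k
    using that(2,1)
  proof (induct rule: inc_induct)
    case base
    show ?case
    proof
      fix x assume x: "x \<in> vanishing ({1, n+1, n+2} \<union> {3..<n+1})"
      have "\<phi> x k = 0" if "k \<noteq> 2" for k
      proof (cases "k \<in> {1, n+1, n+2} \<union> {3..<n+1}")
        case True
        with x show ?thesis by (rule vanishingD(1))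
      next
        case False
        with that x show ?thesis by (intro phi_outside) (auto simp: vanishing_def)
      qed
      then have "x = scale (\<phi> x 2) (E 2)"
        using x n by (intro phi_inject) (auto simp: vanishing_def E scale_in scl fun_eq_iff)
      then show "x \<in> I" using subspace_scale[OF subI E2] by metis
    qed
  next
    case (step k)
    show ?case
    proof
      fix x assume x: "x \<in> vanishing ({1, n+1, n+2} \<union> {3..<k})"
      have k: "k \<in> {1..n+2}" using step by auto
      have "x - scale (\<phi> x k) (br (E k) v) \<in> vanishing ({1, n+1, n+2} \<union> {3..<Suc k})"
      proof -
        have "x \<in> L" using x by (rule vanishingD(2))
        have a: "\<phi> (br (E k) v) j = (if j = k then 1 else 0)"
          if j: "j \<in> {1, n+1, n+2} \<union> {3..<Suc k}" for j
        proof -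
          have k3: "3 \<le> k" "k \<le> n" using step by auto
          consider "j = 1" | "j > n" | "j = k" | "3 \<le> j" "j < k"
            using j by force
          then have "std_bracket n (\<e> k) (\<phi> v) j = (if j = k then 1 else 0)"
            by cases (use k3 n v in \<open>auto simp: std_bracket_def\<close>)
          then show ?thesis using uvL by (simp add: hom E[OF k])
        qed
        have b: "\<phi> x j = 0" if "j \<in> {1, n+1, n+2} \<union> {3..<Suc k}" "j \<noteq> k" for j
          using that by (intro vanishingD(1)[OF x]) auto
        have "\<phi> (x - scale (\<phi> x k) (br (E k) v)) j = \<phi> x j - \<phi> x k * \<phi> (br (E k) v) j" for j
          using \<open>x \<in> L\<close> uvL E(1)[OF k] by (simp add: phi_diff scl scale_in br_closed)
        then have "\<phi> (x - scale (\<phi> x k) (br (E k) v)) j = 0"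
          if "j \<in> {1, n+1, n+2} \<union> {3..<Suc k}" for j
          using a[OF that] b[OF that] by (cases "j = k") simp_all
        moreover have "x - scale (\<phi> x k) (br (E k) v) \<in> L"
          using \<open>x \<in> L\<close> uvL E(1)[OF k] by (simp add: diff_in scale_in br_closed)
        ultimately show ?thesis
          unfolding vanishing_def by blast
      qed
      then have "x - scale (\<phi> x k) (br (E k) v) \<in> I"
        using step by auto
      then show "x \<in> I" by (rule reduce) (intro Ir E k v)
    qed
  qed
  from this[of 3] have van: "x \<in> I" if "x \<in> vanishing {1, n+1, n+2}" for x
    using that n by simp
  show "N \<subseteq> I"
  proof
    fix x assume x: "x \<in> N"
    have "x - scale (\<phi> x 1) (br (E 1) u) \<in> vanishing {1, n+1, n+2}"
      using x uvL u n by (auto simp: vanishing_def phi_diff E br_closed scl scale_in diff_in hom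
          std_bracket_def)
    from van[OF this] show "x \<in> I" by (rule reduce) (intro Ir E u, simp)
  qed
qed

text \<open>With \<open>J\<close> inside \<open>N\<close>, all T- and S-coordinates of elements of
  \<open>L\<close> are already realised in \<open>I\<close>. Then \<open>N_subset_ideal\<close> puts
  \<open>N\<close>, and so \<open>J\<close>, inside \<open>I\<close>.\<close>

lemma not_direct_sum:
  assumes I: "two_sided_ideal scale L br I" and J: "two_sided_ideal scale L br J"
    and int: "I \<inter> J = {0}" and sum: "{x + y | x y. x \<in> I \<and> y \<in> J} = L" and JN: "J \<subseteq> N"
  shows "J = {0}"
proof -
  have IL: "I \<subseteq> L" using I by (simp add: two_sided_ideal_def)
  have *: "\<exists>u \<in> I. \<phi> u (n+1) = \<phi> t (n+1) \<and> \<phi> u (n+2) = \<phi> t (n+2)" if "t \<in> L" for t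
  proof -
    from that sum obtain x y where "t = x + y" "x \<in> I" "y \<in> J" by blast
    with IL JN show ?thesis by (intro bexI[of _ x]) (auto simp: add vanishing_def subset_iff)
  qed
  from *[of "E (n+1)"] obtain u where u: "u \<in> I" "\<phi> u (n+1) = 1" "\<phi> u (n+2) = 0"
    by (auto simp: E)
  from *[of "E (n+2)"] obtain v where v: "v \<in> I" "\<phi> v (n+1) = 0" "\<phi> v (n+2) = 1"
    by (auto simp: E)
  from N_subset_ideal[OF I u v] JN int show ?thesis
    using J by (auto simp: two_sided_ideal_def dest: subspace_0)
qed

lemma indecomposable: "indecomposable_alg scale L br"
  unfolding indecomposable_alg_def
proof (rule notI, elim exE conjE)
  fix I J
  assume I: "two_sided_ideal scale L br I" and J: "two_sided_ideal scale L br J"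
    and "I \<noteq> {0}" "J \<noteq> {0}" and int: "I \<inter> J = {0}"
    and sum: "{x + y | x y. x \<in> I \<and> y \<in> J} = L"
  have sum': "{x + y | x y. x \<in> J \<and> y \<in> I} = L"
    unfolding sum[symmetric] by (intro Collect_cong) (auto, (metis add.commute)+)
  have "E n \<noteq> 0"
    using E(2)[of n] n by (auto simp: fun_eq_iff dest!: spec[of _ n])
  then have "I \<subseteq> N \<or> J \<subseteq> N"
    using E_n_in_ideal[OF I] E_n_in_ideal[OF J] int by blast
  then show False
    using not_direct_sum[OF I J int sum] not_direct_sum[OF J I _ sum'] int \<open>I \<noteq> {0}\<close> \<open>J \<noteq> {0}\<close>
    by (auto simp: Int_commute)
qed

lemma solvable_ext: "solvable_ext_of_L4 n scale L br"
  unfolding solvable_ext_of_L4_def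
  using leibniz_algebra dim solvable indecomposable nilradical_N N_iso_L4 by blast

end

lemma solvable_ext_of_iso_std:
  assumes "n \<ge> 4" and "bilinear_algebra cscale (coords (n + 2)) br"
    and "alg_isomorphic cscale (coords (n + 2)) br cscale (coords (n + 2)) (std_bracket n)"
  shows "solvable_ext_of_L4 n cscale (coords (n + 2)) br"
proof -
  from assms(3) obtain f where "bij_betw f (coords (n + 2)) (coords (n + 2))"
    "\<And>x y. x \<in> coords (n + 2) \<Longrightarrow> y \<in> coords (n + 2) \<Longrightarrow> f (x + y) = f x + f y"
    "\<And>c x. x \<in> coords (n + 2) \<Longrightarrow> f (c \<cdot> x) = c \<cdot> f x"
    "\<And>x y. x \<in> coords (n + 2) \<Longrightarrow> y \<in> coords (n + 2) \<Longrightarrow> f (br x y) = std_bracket n (f x) (f y)"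
    unfolding alg_isomorphic_def by blast
  then have "standard_algebra cscale (coords (n + 2)) br n f"
    by (intro standard_algebra.intro standard_algebra_axioms.intro assms dim_coords)
  then show ?thesis by (rule standard_algebra.solvable_ext)
qed

section \<open>The listed algebras for admissible parameters\<close>

lemma bilinear_g_brackets:
  shows "n \<ge> 4 \<Longrightarrow> bilinear_algebra cscale (coords (n + 2)) (g1_bracket n)"
    and "bilinear_algebra cscale (coords 6) (g2_bracket b)"
    and "bilinear_algebra cscale (coords 6) (g3_bracket b)"
    and "bilinear_algebra cscale (coords 6) (g4_bracket b)"
  unfolding g1_bracket_def g2_bracket_def g3_bracket_def g4_bracket_def
  by (rule bilinear_table_bracket; force simp: L4_table_def coords_def)+

text \<open>The combination \<open>R\<close> scales the functional \<open>x 1 + x 3\<close> by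
  \<open>\<alpha> + \<beta> * (b + 1)\<close> and coordinates 1 and 3 of
  \<open>\<e> 1 - \<e> 3\<close> by \<open>\<alpha>\<close>. Nilpotency makes both factors vanish,
  hence \<open>\<alpha> = \<beta> = 0\<close>.\<close>

lemma admissible2_iff: "admissible2 b \<longleftrightarrow> b \<noteq> -1"
proof -
  have "nil_independent (g2_bracket b)" if "b \<noteq> -1"
    unfolding nil_independent_def
  proof (intro allI impI notI)
    fix \<alpha> \<beta> :: complex
    define R where "R x = \<alpha> \<cdot> g2_bracket b x (\<e> 5) + \<beta> \<cdot> g2_bracket b x (\<e> 6)" for x
    have R_sum: "R x 1 + R x 3 = (\<alpha> + \<beta> * (b + 1)) * (x 1 + x 3)"
      and R_1: "R x 1 = \<alpha> * x 1 + \<beta> * (x 1 + x 3)"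
      and R_3: "R x 3 = \<alpha> * x 3 + \<beta> * b * (x 1 + x 3)" for x
      by (simp_all add: R_def g2_bracket_apply algebra_simps)
    assume ab: "(\<alpha>, \<beta>) \<noteq> (0, 0)" and
      "\<exists>k. \<forall>x \<in> coords 4. ((\<lambda>x. \<alpha> \<cdot> g2_bracket b x (\<e> 5) + \<beta> \<cdot> g2_bracket b x (\<e> 6)) ^^ k) x = 0"
    then obtain k where k: "\<And>x. x \<in> coords 4 \<Longrightarrow> (R ^^ k) x = 0"
      unfolding R_def[abs_def] by blast
    have "(R ^^ j) x 1 + (R ^^ j) x 3 = (\<alpha> + \<beta> * (b + 1)) ^ j * (x 1 + x 3)" for x j
      by (induct j) (simp_all only: funpow.simps comp_apply R_sum power_Suc mult.assoc, simp)
    from this[of k "\<e> 1"] have 1: "\<alpha> + \<beta> * (b + 1) = 0"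
      using k[OF basis_vec_in_coords[of 1 4]] by simp
    have "(R ^^ j) (\<e> 1 - \<e> 3) 1 = \<alpha> ^ j \<and> (R ^^ j) (\<e> 1 - \<e> 3) 3 = - (\<alpha> ^ j)" for j
    proof (induct j)
      case (Suc j)
      then show ?case by (simp only: funpow.simps comp_apply R_1 R_3) simp
    qed simp
    moreover have "\<e> 1 - \<e> 3 \<in> coords 4"
      by (intro cs.subspace_diff subspace_coords basis_vec_in_coords) auto
    ultimately have "\<alpha> ^ k = 0" using k[of "\<e> 1 - \<e> 3"] by (metis zero_fun_apply)
    then have "\<alpha> = 0" by simp
    with 1 that ab show False by (simp add: eq_neg_iff_add_eq_0)
  qed
  then show ?thesis by (auto simp: admissible2_def)
qed

lemma admissible3_imp: "admissible3 c \<Longrightarrow> 2 * c + 1 \<noteq> 0"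
proof
  assume adm: "admissible3 c" and "2 * c + 1 = 0"
  then have c: "c = - 1 / 2" by (simp add: eq_neg_iff_add_eq_0 field_simps)
  \<comment> \<open>At \<open>c = - 1 / 2\<close> both weights of \<open>\<e> 5\<close> are 3/2, and
    both weights of \<open>\<e> 6\<close> are 1; this combination has weight zero.\<close>
  let ?R = "\<lambda>x. 1 \<cdot> g3_bracket c x (\<e> 5) + (- 3 / 2) \<cdot> g3_bracket c x (\<e> 6)"
  have "\<forall>x \<in> coords 4. (?R ^^ 2) x = 0"
    by (auto simp: numeral_2_eq_2 g3_bracket_apply c fun_eq_iff coords_def field_simps)
  moreover have "(1, - 3 / 2) \<noteq> (0::complex, 0::complex)" by simp
  ultimately show False
    using adm unfolding admissible3_def nil_independent_def by blast
qed

lemma admissible4_imp: "admissible4 b \<Longrightarrow> b \<noteq> 2"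
proof
  assume adm: "admissible4 b" and b: "b = 2"
  \<comment> \<open>At \<open>b = 2\<close> the elements \<open>\<e> 5\<close> and
    \<open>\<e> 6\<close> both have weights 1 and 1, so their difference acts nilpotently.\<close>
  let ?R = "\<lambda>x. 1 \<cdot> g4_bracket b x (\<e> 5) + (- 1) \<cdot> g4_bracket b x (\<e> 6)"
  have "\<forall>x \<in> coords 4. (?R ^^ 2) x = 0"
    by (auto simp: numeral_2_eq_2 g4_bracket_apply b fun_eq_iff coords_def field_simps)
  moreover have "(1, - 1) \<noteq> (0::complex, 0::complex)" by simp
  ultimately show False
    using adm unfolding admissible4_def nil_independent_def by blast
qed

lemma solvable_ext_g:
  shows "n \<ge> 4 \<Longrightarrow> solvable_ext_of_L4 n cscale (coords (n + 2)) (g1_bracket n)"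
    and "admissible2 b \<Longrightarrow> solvable_ext_of_L4 4 cscale (coords 6) (g2_bracket b)"
    and "admissible3 b \<Longrightarrow> solvable_ext_of_L4 4 cscale (coords 6) (g3_bracket b)"
    and "admissible4 b \<Longrightarrow> solvable_ext_of_L4 4 cscale (coords 6) (g4_bracket b)"
  using solvable_ext_of_iso_std[of n "g1_bracket n"] solvable_ext_of_iso_std[of 4 "g2_bracket b"]
    solvable_ext_of_iso_std[of 4 "g3_bracket b"] solvable_ext_of_iso_std[of 4 "g4_bracket b"]
    g1_iso_std[of n] g2_iso_std[of b] g3_iso_std[of b] g4_iso_std[of b] bilinear_g_brackets(1)[of n]
    bilinear_g_brackets(2-4)[of b]
    admissible2_iff[of b] admissible3_imp[of b] admissible4_imp[of b]
  by simp_all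

section \<open>Derivations of the nilpotent algebra\<close>

lemma std_bracket_coords:
  assumes "u \<in> coords n" "v \<in> coords n" "n \<ge> 4"
  shows "std_bracket n u v = (\<lambda>k. if k = 2 then u 3 * v 3
    else if k \<in> {4..n} then u (k-1) * v 1 - u 1 * v (k-1) else 0)"
  using assms by (auto simp: std_bracket_def coords_def fun_eq_iff)

text \<open>To be applied to the right multiplications of an extension, restricted to its
  nilradical.\<close>

locale nil_derivation =
  fixes n :: nat and D :: "(nat \<Rightarrow> complex) \<Rightarrow> nat \<Rightarrow> complex"
  assumes n: "n \<ge> 4"
    and D_in: "\<And>u. u \<in> coords n \<Longrightarrow> D u \<in> coords n"
    and D_add: "\<And>u v. u \<in> coords n \<Longrightarrow> v \<in> coords n \<Longrightarrow> D (u + v) = D u + D v"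
    and D_scale: "\<And>c u. u \<in> coords n \<Longrightarrow> D (c \<cdot> u) = c \<cdot> D u"
    and D_br: "\<And>u v. u \<in> coords n \<Longrightarrow> v \<in> coords n \<Longrightarrow>
      D (std_bracket n u v) = std_bracket n (D u) v + std_bracket n u (D v)"
begin

abbreviation B where "B \<equiv> std_bracket n"

definition \<alpha> :: complex where "\<alpha> = D (\<e> 1) 1"
definition \<beta> :: complex where "\<beta> = D (\<e> 3) 3"

lemma e_in: "i \<in> {1..n} \<Longrightarrow> \<e> i \<in> coords n"
  by (rule basis_vec_in_coords)

lemma D_zero: "D 0 = 0"
  using D_scale[of 0 0] by (simp add: coords_def)

lemma D_diff: "u \<in> coords n \<Longrightarrow> v \<in> coords n \<Longrightarrow> D (u - v) = D u - D v"
  using D_add[of "u - v" v] cs.subspace_diff[OF subspace_coords, of u n v] by (simp add: algebra_simps)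

lemma D_expand:
  assumes "u \<in> coords n"
  shows "D u k = (\<Sum>i=1..n. u i * D (\<e> i) k)"
proof -
  have "D (\<Sum>i\<in>A. u i \<cdot> \<e> i) = (\<Sum>i\<in>A. u i \<cdot> D (\<e> i))" if "finite A" "A \<subseteq> {1..n}" for A
    using that
  proof (induct A)
    case (insert i A)
    have "(\<Sum>i\<in>A. u i \<cdot> \<e> i) \<in> coords n"
      using insert by (intro cs.subspace_sum cs.subspace_scale subspace_coords e_in) auto
    moreover have ei: "\<e> i \<in> coords n" using insert by (intro e_in) auto
    moreover have "u i \<cdot> \<e> i \<in> coords n"
      by (rule cs.subspace_scale[OF subspace_coords ei])
    ultimately show ?case
      using insert by (simp add: D_add D_scale del: cscale_apply basis_vec_apply plus_fun_apply)
  qed (simp add: D_zero)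
  from this[of "{1..n}"] have "D u = (\<Sum>i=1..n. u i \<cdot> D (\<e> i))"
    by (simp only: coords_expand[OF assms]) auto
  from fun_cong[OF this, of k] show ?thesis
    by (simp only: sum_fun_apply cscale_apply)
qed

lemma D_e2: "D (\<e> 2) = (2 * \<beta>) \<cdot> \<e> 2"
proof -
  have "\<e> 2 = B (\<e> 3) (\<e> 3)"
    using n by (auto simp: std_bracket_coords e_in fun_eq_iff)
  then have "D (\<e> 2) = B (D (\<e> 3)) (\<e> 3) + B (\<e> 3) (D (\<e> 3))"
    using n D_br[of "\<e> 3" "\<e> 3"] by (simp add: e_in)
  then show ?thesis
    using n by (auto simp: std_bracket_coords e_in D_in \<beta>_def fun_eq_iff)
qed

text \<open>The symmetrised product \<open>B u (\<e> 3) + B (\<e> 3) u\<close> is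
  \<open>(2 * u 3) \<cdot> \<e> 2\<close> and thus detects coordinate 3; apply \<open>D\<close> to
  it and use \<open>D_e2\<close>. In particular \<open>D (\<e> 1)\<close> has no y_0-part, which
  makes \<open>D\<close> triangular.\<close>

lemma D_3:
  assumes u: "u \<in> coords n"
  shows "D u 3 = \<beta> * u 3"
proof -
  have e3: "\<e> 3 \<in> coords n" and e2: "\<e> 2 \<in> coords n" using n by (auto intro: e_in)
  have Bin: "B x y \<in> coords n" if "x \<in> coords n" "y \<in> coords n" for x y
    using that n by (auto simp: std_bracket_coords coords_def)
  have "B u (\<e> 3) + B (\<e> 3) u = (2 * u 3) \<cdot> \<e> 2"
    using u e3 n by (auto simp: std_bracket_coords fun_eq_iff)
  then have "D (B u (\<e> 3)) + D (B (\<e> 3) u) = (2 * u 3) \<cdot> D (\<e> 2)"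
    using D_add[OF Bin Bin, OF u e3 e3 u] D_scale[OF e2] by simp
  then have "(D (B u (\<e> 3)) + D (B (\<e> 3) u)) 2 = ((2 * u 3) \<cdot> D (\<e> 2)) 2" by simp
  then have "2 * D u 3 + 2 * (u 3 * \<beta>) = 2 * u 3 * (2 * \<beta>)"
    using u e3 n by (simp add: D_br D_e2) (simp add: std_bracket_coords D_in \<beta>_def)
  then show ?thesis by algebra
qed

text \<open>The derivation rule for \<open>\<e> k = B (\<e> (k-1)) (\<e> 1)\<close>. No
  \<open>\<e> 2\<close> term appears even for \<open>k = 4\<close>, because \<open>D_3\<close> gives
  \<open>D (\<e> 1) 3 = 0\<close>.\<close>

lemma D_e_Suc:
  assumes "k \<in> {4..n}"
  shows "D (\<e> k) = (\<lambda>j. if j \<in> {4..n} then D (\<e> (k-1)) (j-1) + (if j = k then \<alpha> else 0) else 0)"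
proof -
  have e: "\<e> (k-1) \<in> coords n" "\<e> 1 \<in> coords n" using assms n by (auto intro!: e_in)
  have "\<e> k = B (\<e> (k-1)) (\<e> 1)"
    using assms n by (subst std_bracket_coords[OF e n]) (auto simp: fun_eq_iff)
  then have "D (\<e> k) = B (D (\<e> (k-1))) (\<e> 1) + B (\<e> (k-1)) (D (\<e> 1))"
    using D_br[OF e] by simp
  also have "\<dots> = (\<lambda>j. if j \<in> {4..n} then D (\<e> (k-1)) (j-1) + (if j = k then \<alpha> else 0) else 0)"
    using assms n D_3[OF e(2)] unfolding std_bracket_coords[OF D_in[OF e(1)] e(2) n]
      std_bracket_coords[OF e(1) D_in[OF e(2)] n]
    by (auto simp: fun_eq_iff \<alpha>_def)
  finally show ?thesis .
qed

lemma D_e_triangular: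
  assumes "4 \<le> k" "k \<le> n"
  shows "D (\<e> k) k = of_nat (k - 3) * \<alpha> + \<beta> \<and> (\<forall>j<k. D (\<e> k) j = 0)"
  using assms
proof (induct k rule: dec_induct)
  case base
  show ?case
    using base by (simp add: D_e_Suc \<beta>_def del: basis_vec_apply)
next
  case (step m)
  have "D (\<e> m) m = of_nat (m - 3) * \<alpha> + \<beta>" "\<forall>j<m. D (\<e> m) j = 0"
    using step(3,4) by (blast dest: Suc_leD)+
  with step(1) \<open>Suc m \<le> n\<close> show ?case
    by (auto simp: D_e_Suc[of "Suc m"] Suc_diff_le algebra_simps simp del: basis_vec_apply)
qed

lemma D_1:
  assumes "u \<in> coords n"
  shows "D u 1 = \<alpha> * u 1 + D (\<e> 3) 1 * u 3"
proof -
  have "(\<Sum>i=1..n. u i * D (\<e> i) 1) = (\<Sum>i\<in>{1,3}. u i * D (\<e> i) 1)"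
  proof (rule sum.mono_neutral_right)
    show "\<forall>i\<in>{1..n} - {1, 3}. u i * D (\<e> i) 1 = 0"
    proof
      fix i assume "i \<in> {1..n} - {1, 3}"
      then have "i = 2 \<or> i \<in> {4..n}" by auto
      then show "u i * D (\<e> i) 1 = 0" by (auto simp: D_e2 D_e_Suc)
    qed
  qed (use n in auto)
  then show ?thesis by (simp add: D_expand[OF assms] \<alpha>_def)
qed

lemma D_2:
  assumes "u \<in> coords n" "u 1 = 0" "u 3 = 0"
  shows "D u 2 = 2 * \<beta> * u 2"
proof -
  have "(\<Sum>i=1..n. u i * D (\<e> i) 2) = (\<Sum>i\<in>{2}. u i * D (\<e> i) 2)"
  proof (rule sum.mono_neutral_right)
    show "\<forall>i\<in>{1..n} - {2}. u i * D (\<e> i) 2 = 0"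
    proof
      fix i assume "i \<in> {1..n} - {2}"
      then have "i = 1 \<or> i = 3 \<or> i \<in> {4..n}" by auto
      then show "u i * D (\<e> i) 2 = 0"
        using assms(2,3) by (elim disjE) (simp_all add: D_e_Suc)
    qed
  qed (use n in auto)
  then show ?thesis by (simp add: D_expand[OF assms(1)] D_e2)
qed

lemma D_k:
  assumes "u \<in> coords n" "u 1 = 0" "u 3 = 0" "\<And>j. j \<in> {4..<k} \<Longrightarrow> u j = 0" "k \<in> {4..n}"
  shows "D u k = (of_nat (k - 3) * \<alpha> + \<beta>) * u k"
proof -
  have "(\<Sum>i=1..n. u i * D (\<e> i) k) = (\<Sum>i\<in>{k}. u i * D (\<e> i) k)"
  proof (rule sum.mono_neutral_right)
    show "\<forall>i\<in>{1..n} - {k}. u i * D (\<e> i) k = 0"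
    proof
      fix i assume "i \<in> {1..n} - {k}"
      then consider "i = 1 \<or> i = 3" | "i = 2" | "i \<in> {4..<k}" | "i \<in> {4..n}" "k < i" by force
      then show "u i * D (\<e> i) k = 0"
        using assms D_e_triangular[of i] by cases (auto simp: D_e2)
    qed
  qed (use assms in auto)
  then show ?thesis
    using D_e_triangular[of k] assms by (simp add: D_expand[OF assms(1)])
qed

text \<open>For \<open>k \<ge> 4\<close> this is the span of \<open>\<e> 2\<close> and
  \<open>\<e> k\<close>, ..., \<open>\<e> n\<close>: a flag on which \<open>D\<close> is triangular,
  with \<open>\<e> 2\<close> kept in every member.\<close>

definition W :: "nat \<Rightarrow> (nat \<Rightarrow> complex) set" where
  "W k = {u \<in> coords n. u 1 = 0 \<and> u 3 = 0 \<and> (\<forall>j \<in> {4..<k}. u j = 0)}"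

lemma subspace_W: "cs.subspace (W k)"
  by (auto simp: cs.subspace_def W_def coords_def)

lemma D_W:
  assumes "u \<in> W k"
  shows "D u \<in> W k"
proof -
  have u: "u \<in> coords n" "u 1 = 0" "u 3 = 0" "\<And>j. j \<in> {4..<k} \<Longrightarrow> u j = 0"
    using assms by (auto simp: W_def)
  have "D u j = 0" if "j \<in> {4..<k}" for j
  proof (cases "j \<le> n")
    case True
    with D_k[of u j] u that show ?thesis by simp
  next
    case False
    with D_in[OF u(1)] show ?thesis by (simp add: coords_def)
  qed
  with u D_1[OF u(1)] D_3[OF u(1)] D_in show ?thesis by (simp add: W_def)
qed

text \<open>The diagonal entries of \<open>D\<close> on \<open>W 4\<close> are exactly the excluded
  values of \<open>c\<close>; coordinates 4, ..., n and then 2 are forced to vanish in turn.\<close>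

lemma eigen_W_zero:
  assumes u: "u \<in> W 4" and eig: "D u = c \<cdot> u"
    and c: "c \<noteq> 2 * \<beta>" "\<And>k. k \<in> {4..n} \<Longrightarrow> c \<noteq> of_nat (k - 3) * \<alpha> + \<beta>"
  shows "u = 0"
proof -
  have u': "u \<in> coords n" "u 1 = 0" "u 3 = 0" using u by (auto simp: W_def)
  have hi: "k \<in> {4..n} \<longrightarrow> u k = 0" for k
  proof (induct k rule: less_induct)
    case (less k)
    show ?case
    proof
      assume k: "k \<in> {4..n}"
      then have "D u k = (of_nat (k - 3) * \<alpha> + \<beta>) * u k"
        using less u' by (intro D_k) auto
      with eig c(2)[OF k] show "u k = 0" by simp
    qed
  qed
  have "u 2 = 0" using D_2[OF u'] eig c(1) by simp
  have "u k = 0" for k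
  proof -
    consider "k \<notin> {1..n}" | "k = 1" | "k = 2" | "k = 3" | "k \<in> {4..n}" by fastforce
    then show ?thesis using u' \<open>u 2 = 0\<close> hi[of k] by cases (auto simp: coords_def)
  qed
  then show ?thesis by (simp add: fun_eq_iff)
qed

text \<open>Off the diagonal entries \<open>D - c\<close> is invertible on \<open>W 4\<close>. The
  equation is solved by correcting the leading coordinate, by downward induction from
  \<open>W (n + 1)\<close>, the line of \<open>\<e> 2\<close>.\<close>

lemma solve_W:
  assumes w: "w \<in> W 4"
    and c: "c \<noteq> 2 * \<beta>" "\<And>k. k \<in> {4..n} \<Longrightarrow> c \<noteq> of_nat (k - 3) * \<alpha> + \<beta>"
  shows "\<exists>u \<in> W 4. D u - c \<cdot> u = w"
proof -
  have "\<forall>w \<in> W k. \<exists>u \<in> W k. D u - c \<cdot> u = w" if "k \<le> n + 1" "4 \<le> k" for k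
    using that
  proof (induct rule: inc_induct)
    case base
    show ?case
    proof
      fix w assume w: "w \<in> W (n+1)"
      define d where "d = w 2 / (2 * \<beta> - c)"
      have "w k = 0" if "k \<noteq> 2" for k
      proof -
        from \<open>k \<noteq> 2\<close> consider "k \<notin> {1..n}" | "k = 1" | "k = 3" | "k \<in> {4..n}" by fastforce
        then show ?thesis using w by cases (auto simp: W_def coords_def)
      qed
      moreover have "D (d \<cdot> \<e> 2) - c \<cdot> (d \<cdot> \<e> 2) = ((2 * \<beta> - c) * d) \<cdot> \<e> 2"
        using n by (simp add: D_scale e_in D_e2 fun_eq_iff algebra_simps)
      moreover have "(2 * \<beta> - c) * d = w 2" using c(1) by (simp add: d_def)
      ultimately have "D (d \<cdot> \<e> 2) - c \<cdot> (d \<cdot> \<e> 2) = w" by (auto simp: fun_eq_iff)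
      moreover have "d \<cdot> \<e> 2 \<in> W (n+1)" using n by (auto simp: W_def coords_def)
      ultimately show "\<exists>u \<in> W (n+1). D u - c \<cdot> u = w" by blast
    qed
  next
    case (step k)
    then have k: "k \<in> {4..n}" by auto
    show ?case
    proof
      fix w assume w: "w \<in> W k"
      define \<mu> where "\<mu> = of_nat (k - 3) * \<alpha> + \<beta>"
      define v where "v = (w k / (\<mu> - c)) \<cdot> \<e> k"
      have v: "v \<in> W k" using k by (auto simp: W_def coords_def v_def)
      then have "D v k = \<mu> * v k"
        using k unfolding \<mu>_def by (intro D_k) (auto simp: W_def)
      moreover have "c \<noteq> \<mu>" using c(2)[OF k] by (simp add: \<mu>_def)
      ultimately have "(D v - c \<cdot> v) k = w k"
        by (simp add: v_def field_simps)
      moreover have "w - (D v - c \<cdot> v) \<in> W k"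
        by (intro cs.subspace_diff cs.subspace_scale subspace_W D_W w v)
      ultimately have "w - (D v - c \<cdot> v) \<in> W (Suc k)"
        by (auto simp: W_def less_Suc_eq)
      then obtain u where u: "u \<in> W (Suc k)" "D u - c \<cdot> u = w - (D v - c \<cdot> v)"
        using step(3) step(4) by (meson le_SucI)
      have uk: "u \<in> W k" using u by (auto simp: W_def)
      have "D (u + v) - c \<cdot> (u + v) = (D u - c \<cdot> u) + (D v - c \<cdot> v)"
        using uk v by (simp add: D_add W_def cs.scale_right_distrib algebra_simps)
      with u have "D (u + v) - c \<cdot> (u + v) = w" by simp
      moreover have "u + v \<in> W k" by (intro cs.subspace_add subspace_W uk v)
      ultimately show "\<exists>u \<in> W k. D u - c \<cdot> u = w" by blast
    qed
  qed
  from this[of 4] w n show ?thesis by simp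
qed

end

section \<open>Derivations with weights 1 and \<i>\<close>

locale regular_derivation = nil_derivation +
  assumes \<alpha>_1: "\<alpha> = 1" and \<beta>_i: "\<beta> = \<i>"
begin

text \<open>The weights on \<open>W 4\<close> are \<open>2 * \<i>\<close> and m + \<i> with m
  positive. Real and imaginary parts separate them from 0, 1, \<i> and from j + 2\<i> with j
  positive, the weight of a bracket of y_a and y_b with a + b = j.\<close>

lemma weights_nonresonant:
  assumes "c = 0 \<or> c = 1 \<or> c = \<i> \<or> (\<exists>j::nat. 0 < j \<and> c = of_nat j + 2 * \<i>)"
  shows "c \<noteq> 2 * \<beta>" and "k \<in> {4..n} \<Longrightarrow> c \<noteq> of_nat (k - 3) * \<alpha> + \<beta>"
  using assms by (auto simp: \<alpha>_1 \<beta>_i complex_eq_iff)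

lemma eigen_vanish:
  assumes u: "u \<in> coords n" and eig: "D u = c \<cdot> u"
    and c: "c = 0 \<or> (\<exists>j::nat. 0 < j \<and> c = of_nat j + 2 * \<i>)"
  shows "u = 0"
proof (rule eigen_W_zero[OF _ eig])
  have "c \<noteq> 1" "c \<noteq> \<i>" using c by (auto simp: complex_eq_iff)
  then have "u 3 = 0" using D_3[OF u] eig by (simp add: \<beta>_i)
  moreover from this have "u 1 = 0" using D_1[OF u] eig \<open>c \<noteq> 1\<close> by (simp add: \<alpha>_1)
  ultimately show "u \<in> W 4" using u by (simp add: W_def)
qed (use weights_nonresonant c in blast)+

text \<open>No weight is 0. Coordinate 3 is matched before coordinate 1, since
  \<open>D (\<e> 3)\<close> may have an \<open>\<e> 1\<close>-part; the remainder lies in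
  \<open>W 4\<close>.\<close>

lemma D_surj:
  assumes w: "w \<in> coords n"
  shows "\<exists>u \<in> coords n. D u = w"
proof -
  have e: "\<e> 1 \<in> coords n" "\<e> 3 \<in> coords n" using n by (auto intro: e_in)
  define a where "a = (w 3 / \<i>) \<cdot> \<e> 3"
  have a: "a \<in> coords n" by (simp only: a_def cs.subspace_scale[OF subspace_coords e(2)])
  define b where "b = (w 1 - D a 1) \<cdot> \<e> 1"
  have b: "b \<in> coords n" by (simp only: b_def cs.subspace_scale[OF subspace_coords e(1)])
  have ab: "D a \<in> coords n" "D b \<in> coords n" by (simp_all add: D_in a b)
  have "w - D a - D b \<in> W 4"
    using D_3[OF a] D_3[OF b] D_1[OF b] ab w
    by (auto simp: W_def \<alpha>_1 \<beta>_i a_def b_def intro!: cs.subspace_diff subspace_coords)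
  from solve_W[OF this weights_nonresonant[of 0]] obtain u where
    "u \<in> W 4" "D u - 0 \<cdot> u = w - D a - D b" by auto
  then have "u + a + b \<in> coords n" "D (u + a + b) = w"
    using a b by (auto simp: D_add W_def cs.subspace_add subspace_coords)
  then show ?thesis by blast
qed

lemma eigenvectors_exist:
  "\<exists>x y. x \<in> coords n \<and> y \<in> coords n \<and> D x = x \<and> D y = \<i> \<cdot> y \<and> x 1 = 1 \<and> x 3 = 0 \<and> y 3 = 1"
proof -
  have e: "\<e> 1 \<in> coords n" "\<e> 3 \<in> coords n" using n by (auto intro: e_in)
  have "\<e> 1 - D (\<e> 1) \<in> W 4"
    using D_1[OF e(1)] D_3[OF e(1)] D_in[OF e(1)] e
    by (auto simp: W_def \<alpha>_1 intro!: cs.subspace_diff subspace_coords)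
  from solve_W[OF this weights_nonresonant[of 1]] obtain u where
    u: "u \<in> W 4" "D u - 1 \<cdot> u = \<e> 1 - D (\<e> 1)" by auto
  define x where "x = \<e> 1 + u"
  have uc: "u \<in> coords n" using u by (simp add: W_def)
  have Dx: "D x = x" using u(2) unfolding x_def D_add[OF e(1) uc] by (simp add: algebra_simps)
  have x: "x \<in> coords n" "x 1 = 1" "x 3 = 0"
    using u(1) e by (auto simp: x_def W_def intro!: cs.subspace_add subspace_coords)
  \<comment> \<open>\<open>D (\<e> 3)\<close> may have an \<open>\<e> 1\<close>-component; this
    multiple of the eigenvector \<open>x\<close> cancels it, so that \<open>\<e> 3 + a\<close> is an
    eigenvector modulo \<open>W 4\<close>.\<close>
  define a where "a = (- D (\<e> 3) 1 / (1 - \<i>)) \<cdot> x"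
  have a: "a \<in> coords n" "D a = a" unfolding a_def
    by (rule cs.subspace_scale[OF subspace_coords x(1)], simp only: D_scale[OF x(1)] Dx)
  have "1 - \<i> \<noteq> 0" by (simp add: complex_eq_iff)
  then have "(\<i> \<cdot> \<e> 3 - D (\<e> 3)) - (1 - \<i>) \<cdot> a \<in> W 4"
    using D_3[OF e(2)] D_in[OF e(2)] e a(1) x
    by (auto simp: W_def \<beta>_i intro!: cs.subspace_diff cs.subspace_scale subspace_coords)
      (simp_all add: a_def)
  from solve_W[OF this weights_nonresonant[of \<i>]] obtain v where
    v: "v \<in> W 4" "D v - \<i> \<cdot> v = (\<i> \<cdot> \<e> 3 - D (\<e> 3)) - (1 - \<i>) \<cdot> a" by auto
  have vc: "v \<in> coords n" using v by (simp add: W_def)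
  define y where "y = \<e> 3 + a + v"
  have "D y = D (\<e> 3) + a + (\<i> \<cdot> v + ((\<i> \<cdot> \<e> 3 - D (\<e> 3)) - (1 - \<i>) \<cdot> a))"
    using v(2) e a vc by (simp add: y_def D_add cs.subspace_add[OF subspace_coords] flip: v(2))
  also have "\<dots> = \<i> \<cdot> y"
    by (simp add: y_def fun_eq_iff algebra_simps)
  finally have "D y = \<i> \<cdot> y" .
  moreover have "y \<in> coords n"
    unfolding y_def by (intro cs.subspace_add subspace_coords e a vc)
  moreover have "y 3 = 1" using v(1) x(3) by (simp add: y_def W_def a_def)
  ultimately show ?thesis using x Dx by blast
qed

end

section \<open>Basis of eigenvectors\<close>

locale eigenframe = regular_derivation +
  fixes x y :: "nat \<Rightarrow> complex"
  assumes x_in: "x \<in> coords n" and y_in: "y \<in> coords n"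
    and D_x: "D x = x" and D_y: "D y = \<i> \<cdot> y"
    and x_1: "x 1 = 1" and x_3: "x 3 = 0" and y_3: "y 3 = 1"
begin

primrec Y :: "nat \<Rightarrow> nat \<Rightarrow> complex" where
  "Y 0 = y"
| "Y (Suc j) = B (Y j) x"

lemma B_in: "u \<in> coords n \<Longrightarrow> v \<in> coords n \<Longrightarrow> B u v \<in> coords n"
  using n by (auto simp: std_bracket_coords coords_def)

lemma Y_in: "Y j \<in> coords n"
  by (induct j) (simp_all add: y_in x_in B_in)

lemma D_Y: "D (Y j) = (of_nat j + \<i>) \<cdot> Y j"
proof (induct j)
  case (Suc j)
  have "D (Y (Suc j)) = B ((of_nat j + \<i>) \<cdot> Y j) x + B (Y j) x"
    unfolding Y.simps D_br[OF Y_in x_in] Suc D_x ..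
  then show ?case
    by (simp add: std_bracket_def fun_eq_iff algebra_simps)
qed (simp add: D_y)

text \<open>The vectors \<open>Y j\<close> agree with the standard chain up to later members; this
  triangularity yields both the spanning property and the end of the chain.\<close>

lemma Y_Suc: "Y (Suc j) \<in> W (j + 4)" "j + 4 \<le> n \<Longrightarrow> Y (Suc j) (j + 4) = 1" "Y (Suc j) 2 = 0"
proof (induct j)
  case 0
  have "Y (Suc 0) = (\<lambda>k. if k \<in> {4..n} then y (k-1) * x 1 - y 1 * x (k-1) else 0)"
    using std_bracket_coords[OF y_in x_in n] by (auto simp: x_3)
  then show "Y (Suc 0) \<in> W (0 + 4)" "0 + 4 \<le> n \<Longrightarrow> Y (Suc 0) (0 + 4) = 1" "Y (Suc 0) 2 = 0"
    using n y_3 x_1 x_3 Y_in[of "Suc 0"] by (auto simp: W_def simp del: Y.simps)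
next
  case (Suc j)
  have Y'_zero: "Y (Suc j) (k - 1) = 0" if "k \<in> {4..<Suc j + 4}" for k
  proof -
    from that consider "k - 1 = 3" | "k - 1 \<in> {4..<j + 4}" by fastforce
    then show ?thesis using Suc(1) by cases (auto simp: W_def simp del: Y.simps)
  qed
  have "Y (Suc (Suc j)) = (\<lambda>k. if k \<in> {4..n} then Y (Suc j) (k-1) else 0)"
    using std_bracket_coords[OF Y_in x_in n, of "Suc j"] x_1 x_3 Suc(1)
    by (auto simp: W_def fun_eq_iff)
  then show "Y (Suc (Suc j)) \<in> W (Suc j + 4)" "Suc j + 4 \<le> n \<Longrightarrow> Y (Suc (Suc j)) (Suc j + 4) = 1"
      "Y (Suc (Suc j)) 2 = 0"
    using n Suc(1,2) Y_in[of "Suc (Suc j)"] Y'_zero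
    by (auto simp: W_def add.commute[of 4 j] simp del: Y.simps)
qed

lemma Y_zero:
  assumes "n < j + 3"
  shows "Y j = 0"
proof
  fix k
  obtain i where j: "j = Suc i" using assms n by (cases j) auto
  consider "k \<notin> {1..n}" | "k = 1" | "k = 2" | "k = 3" | "k \<in> {4..n}" by fastforce
  then show "Y j k = 0 k"
    using Y_Suc(1,3)[of i] assms by cases (auto simp: W_def coords_def j)
qed

lemma B_antisym:
  assumes "u \<in> coords n" "v \<in> coords n" "u 3 * v 3 = 0"
  shows "B u v = - B v u"
  using assms n by (auto simp: std_bracket_coords fun_eq_iff)

lemma B_x_x: "B x x = 0"
  using n by (auto simp: std_bracket_coords x_in x_3 fun_eq_iff)

lemma B_x_Y: "B x (Y j) = - Y (Suc j)"
  using B_antisym[OF x_in Y_in] x_3 by simp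

lemma B_Y_x: "B (Y j) x = Y (Suc j)"
  by simp

lemma B_y_y: "B y y = \<e> 2"
  using n by (auto simp: std_bracket_coords y_in y_3 fun_eq_iff)

lemma B_e2: "v \<in> coords n \<Longrightarrow> B (\<e> 2) v = 0" "v \<in> coords n \<Longrightarrow> B v (\<e> 2) = 0"
  using n by (auto simp: std_bracket_coords e_in fun_eq_iff)

text \<open>The bracket would be an eigenvector for (i + j) + 2\<i>, which is no eigenvalue of
  \<open>D\<close> when \<open>i + j\<close> is positive.\<close>

lemma B_Y_Y:
  assumes "0 < i + j"
  shows "B (Y i) (Y j) = 0"
proof (rule eigen_vanish[OF B_in[OF Y_in Y_in]])
  show "D (B (Y i) (Y j)) = (of_nat (i + j) + 2 * \<i>) \<cdot> B (Y i) (Y j)"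
    by (simp add: D_br Y_in D_Y) (simp add: std_bracket_def fun_eq_iff algebra_simps)
qed (use assms in blast)

text \<open>The difference \<open>u - u 1 \<cdot> x\<close> still satisfies the eigenvalue equation
  but lies in \<open>W 4\<close>, where 1 is not a weight. So the eigenspace is a line;
  \<open>eigen_y\<close> argues in the same way.\<close>

lemma eigen_x:
  assumes u: "u \<in> coords n" and "D u = u"
  shows "u = u 1 \<cdot> x"
proof -
  have "(1 - \<i>) * u 3 = u 3 - D u 3"
    unfolding D_3[OF u] \<beta>_i by (simp add: algebra_simps)
  then have "(1 - \<i>) * u 3 = 0" by (simp add: assms(2))
  then have "u 3 = 0" by (simp add: complex_eq_iff[of 1])
  have ux: "u 1 \<cdot> x \<in> coords n" by (rule cs.subspace_scale[OF subspace_coords x_in])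
  have "u - u 1 \<cdot> x = 0"
  proof (rule eigen_W_zero[OF _ _ weights_nonresonant[of 1]])
    show "u - u 1 \<cdot> x \<in> W 4"
      using u ux \<open>u 3 = 0\<close> by (auto simp: W_def x_1[simplified] x_3 intro!: cs.subspace_diff subspace_coords)
    show "D (u - u 1 \<cdot> x) = 1 \<cdot> (u - u 1 \<cdot> x)"
      by (simp only: D_diff[OF u ux] D_scale[OF x_in] D_x assms(2) cs.scale_one)
  qed auto
  then show ?thesis by simp
qed

lemma eigen_y:
  assumes u: "u \<in> coords n" and "D u = \<i> \<cdot> u"
  shows "u = u 3 \<cdot> y"
proof -
  have uy: "u 3 \<cdot> y \<in> coords n" by (rule cs.subspace_scale[OF subspace_coords y_in])
  define v where "v = u - u 3 \<cdot> y"
  have v: "v \<in> coords n" unfolding v_def by (intro cs.subspace_diff subspace_coords u uy)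
  have Dv: "D v = \<i> \<cdot> v"
    unfolding v_def by (simp add: D_diff[OF u uy] D_scale[OF y_in] D_y assms(2) fun_eq_iff algebra_simps)
  have "v 3 = 0" by (simp add: v_def y_3)
  then have "v 1 = 0" using D_1[OF v] Dv by (auto simp: \<alpha>_1 complex_eq_iff)
  then have "v = 0"
    using v \<open>v 3 = 0\<close> by (intro eigen_W_zero[OF _ Dv weights_nonresonant]) (auto simp: W_def)
  then show ?thesis by (simp add: v_def)
qed

lemma coords_subset_span: "coords n \<subseteq> cs.span ({x, \<e> 2} \<union> Y ` {..n - 3})" (is "_ \<subseteq> cs.span ?S")
proof -
  have "W k \<subseteq> cs.span ?S" if "k \<le> n + 1" "4 \<le> k" for k
    using that
  proof (induct rule: inc_induct)
    case base
    show ?case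
    proof
      fix w assume w: "w \<in> W (n+1)"
      have "w k = 0" if "k \<noteq> 2" for k
      proof -
        from that consider "k \<notin> {1..n}" | "k = 1" | "k = 3" | "k \<in> {4..n}" by fastforce
        then show ?thesis using w by cases (auto simp: W_def coords_def)
      qed
      then have "w = w 2 \<cdot> \<e> 2" by (auto simp: fun_eq_iff)
      moreover have "w 2 \<cdot> \<e> 2 \<in> cs.span ?S" by (intro cs.span_scale cs.span_base) auto
      ultimately show "w \<in> cs.span ?S" by simp
    qed
  next
    case (step m)
    show ?case
    proof
      fix w assume w: "w \<in> W m"
      obtain j where m: "m = j + 4" using \<open>4 \<le> m\<close> by (metis add.commute le_Suc_ex)
      have j: "j + 4 \<le> n" using step m by simp
      have "w - w m \<cdot> Y (Suc j) \<in> W m"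
        using Y_Suc(1)[of j] w m by (intro cs.subspace_diff cs.subspace_scale subspace_W) auto
      moreover have "(w - w m \<cdot> Y (Suc j)) m = 0"
        using Y_Suc(2)[OF j] m by (simp del: Y.simps)
      ultimately have "w - w m \<cdot> Y (Suc j) \<in> W (Suc m)"
        by (auto simp: W_def less_Suc_eq simp del: Y.simps)
      then have "w - w m \<cdot> Y (Suc j) \<in> cs.span ?S" using step(3) \<open>4 \<le> m\<close> by (meson le_SucI subsetD)
      moreover have "w m \<cdot> Y (Suc j) \<in> cs.span ?S"
        using j by (intro cs.span_scale cs.span_base) (auto simp del: Y.simps)
      ultimately have "(w - w m \<cdot> Y (Suc j)) + w m \<cdot> Y (Suc j) \<in> cs.span ?S"
        by (rule cs.span_add)
      then show "w \<in> cs.span ?S" by simp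
    qed
  qed
  from this[of 4] have W4: "W 4 \<subseteq> cs.span ?S" using n by simp
  show ?thesis
  proof
    fix v assume v: "v \<in> coords n"
    \<comment> \<open>The vector \<open>y\<close> may have a coordinate 1 while \<open>x\<close> has
      no coordinate 3, so the part along \<open>y\<close> is removed first.\<close>
    define a where "a = v 3 \<cdot> y"
    have a: "a \<in> coords n" unfolding a_def by (rule cs.subspace_scale[OF subspace_coords y_in])
    define b where "b = (v 1 - a 1) \<cdot> x"
    have b: "b \<in> coords n" unfolding b_def by (rule cs.subspace_scale[OF subspace_coords x_in])
    have "v - a - b \<in> W 4"
      using v a b by (auto simp: W_def b_def x_1[simplified] x_3 intro!: cs.subspace_diff subspace_coords)
        (simp add: a_def y_3)
    moreover have "a \<in> cs.span ?S" "b \<in> cs.span ?S"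
      unfolding a_def b_def by (intro cs.span_scale cs.span_base; force intro: image_eqI[of _ _ 0])+
    ultimately have "(v - a - b) + a + b \<in> cs.span ?S"
      using W4 by (intro cs.span_add) auto
    then show "v \<in> cs.span ?S" by simp
  qed
qed

end

section \<open>Classification of the extensions\<close>

text \<open>The map \<open>c\<close> identifies the nilradical with the standard form of L^4, so
  that right multiplications on it become maps of coordinates.\<close>

locale L4_extension = leibniz_algebra scale L br + bilinear_algebra scale L br
  for scale :: "complex \<Rightarrow> 'a::ab_group_add \<Rightarrow> 'a" and L br +
  fixes n :: nat and N :: "'a set" and c :: "'a \<Rightarrow> nat \<Rightarrow> complex"
  assumes n: "n \<ge> 4" and dim: "dim L = n + 2" and solvable: "solvable_alg scale L br"
    and N_max: "maximal_nilpotent_ideal scale L br N"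
    and c_bij: "bij_betw c N (coords n)"
    and c_add: "\<And>x y. x \<in> N \<Longrightarrow> y \<in> N \<Longrightarrow> c (x + y) = c x + c y"
    and c_scale: "\<And>k x. x \<in> N \<Longrightarrow> c (scale k x) = k \<cdot> c x"
    and c_br: "\<And>x y. x \<in> N \<Longrightarrow> y \<in> N \<Longrightarrow> c (br x y) = std_bracket n (c x) (c y)"
begin

definition h :: "(nat \<Rightarrow> complex) \<Rightarrow> 'a" where "h = inv_into N c"

lemma N_ideal: "two_sided_ideal scale L br N"
  using N_max by (simp add: maximal_nilpotent_ideal_def)

lemma N_subspace: "subspace N" and N_sub: "N \<subseteq> L"
  and br_N_right: "x \<in> L \<Longrightarrow> y \<in> N \<Longrightarrow> br x y \<in> N"
  and br_N_left: "x \<in> N \<Longrightarrow> y \<in> L \<Longrightarrow> br x y \<in> N"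
  using N_ideal by (auto simp: two_sided_ideal_def)

lemma h_in: "v \<in> coords n \<Longrightarrow> h v \<in> N"
  and c_h: "v \<in> coords n \<Longrightarrow> c (h v) = v"
  and h_c: "x \<in> N \<Longrightarrow> h (c x) = x"
  and c_in: "x \<in> N \<Longrightarrow> c x \<in> coords n"
  using c_bij unfolding h_def
  by (metis bij_betw_def inv_into_into, metis bij_betw_inv_into_right,
      metis bij_betw_inv_into_left, metis bij_betw_apply)

lemma h_in_L: "v \<in> coords n \<Longrightarrow> h v \<in> L"
  using h_in N_sub by blast

lemma h_add: "u \<in> coords n \<Longrightarrow> v \<in> coords n \<Longrightarrow> h (u + v) = h u + h v"
  using h_c[of "h u + h v"] by (simp add: c_add h_in c_h subspace_add[OF N_subspace])

lemma h_scale: "v \<in> coords n \<Longrightarrow> h (k \<cdot> v) = scale k (h v)"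
  using h_c[of "scale k (h v)"] by (simp add: c_scale h_in c_h subspace_scale[OF N_subspace])

lemma h_br: "u \<in> coords n \<Longrightarrow> v \<in> coords n \<Longrightarrow> h (std_bracket n u v) = br (h u) (h v)"
  using h_c[of "br (h u) (h v)"] by (simp add: c_br h_in c_h br_N_right h_in_L)

lemma h_zero: "h 0 = 0"
  using h_scale[of 0 0] by (simp add: coords_def)

lemma h_uminus: "v \<in> coords n \<Longrightarrow> h (- v) = - h v"
  using h_scale[of v "-1"] by simp

section \<open>Right multiplications on the nilradical and their weights\<close>

definition R :: "'a \<Rightarrow> (nat \<Rightarrow> complex) \<Rightarrow> nat \<Rightarrow> complex" where
  "R z v = c (br (h v) z)"

lemma R_in: "z \<in> L \<Longrightarrow> v \<in> coords n \<Longrightarrow> R z v \<in> coords n"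
  and h_R: "z \<in> L \<Longrightarrow> v \<in> coords n \<Longrightarrow> h (R z v) = br (h v) z"
  by (simp_all add: R_def c_in br_N_left h_in h_c)

text \<open>The right Leibniz identity says precisely that right multiplications are
  derivations.\<close>

lemma R_derivation:
  assumes z: "z \<in> L"
  shows "nil_derivation n (R z)"
proof
  fix u v :: "nat \<Rightarrow> complex" and k
  assume u: "u \<in> coords n" and v: "v \<in> coords n"
  show "R z (u + v) = R z u + R z v"
    using u v z by (simp add: R_def h_add br_add_left h_in_L c_add br_N_left h_in)
  have "br (br (h u) (h v)) z = br (br (h u) z) (h v) + br (h u) (br (h v) z)"
    using u v z by (intro leibniz h_in_L)
  then show "R z (std_bracket n u v) = std_bracket n (R z u) v + std_bracket n u (R z v)"
    using u v z by (simp add: R_def h_br c_add c_br c_h h_in h_in_L br_N_left br_N_right br_closed)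
next
  fix u :: "nat \<Rightarrow> complex" and k
  assume u: "u \<in> coords n"
  then show "R z u \<in> coords n" by (rule R_in[OF z])
  show "R z (k \<cdot> u) = k \<cdot> R z u"
    using u z by (simp add: R_def h_scale br_scale_left h_in_L c_scale br_N_left h_in)
qed (fact n)

lemma R_add: "z \<in> L \<Longrightarrow> w \<in> L \<Longrightarrow> v \<in> coords n \<Longrightarrow> R (z + w) v = R z v + R w v"
  by (simp add: R_def br_add_right h_in_L c_add br_N_left h_in)

lemma R_scale: "z \<in> L \<Longrightarrow> v \<in> coords n \<Longrightarrow> R (scale k z) v = k \<cdot> R z v"
  by (simp add: R_def br_scale_right h_in_L c_scale br_N_left h_in)

lemma R_diff: "z \<in> L \<Longrightarrow> w \<in> L \<Longrightarrow> v \<in> coords n \<Longrightarrow> R (z - w) v = R z v - R w v"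
  using R_add[of "z - w" w v] by (simp add: diff_in algebra_simps)

lemma R_N: "z \<in> N \<Longrightarrow> v \<in> coords n \<Longrightarrow> R z v = std_bracket n v (c z)"
  by (simp add: R_def c_br h_in c_h)

lemma R_bracket:
  assumes "z \<in> L" "w \<in> L" "v \<in> coords n"
  shows "R (br z w) v = R w (R z v) - R z (R w v)"
proof -
  have "br (br (h v) z) w = br (br (h v) w) z + br (h v) (br z w)"
    using assms by (intro leibniz h_in_L)
  then have "c (br (br (h v) z) w) = c (br (br (h v) w) z) + c (br (h v) (br z w))"
    using assms by (simp add: c_add br_N_left h_in br_closed)
  then show ?thesis using assms by (simp add: R_def h_R[unfolded R_def])
qed

text \<open>Together with \<open>wy\<close> this is the weight map: the diagonal entries of the
  derivation \<open>R z\<close> on x and y_0.\<close>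

definition wx :: "'a \<Rightarrow> complex" where "wx z = R z (\<e> 1) 1"
definition wy :: "'a \<Rightarrow> complex" where "wy z = R z (\<e> 3) 3"

lemma e_in: "i \<in> {1..n} \<Longrightarrow> \<e> i \<in> coords n"
  by (rule basis_vec_in_coords)

lemma R_weights: "z \<in> L \<Longrightarrow> nil_derivation.\<alpha> (R z) = wx z" "z \<in> L \<Longrightarrow> nil_derivation.\<beta> (R z) = wy z"
  using R_derivation[of z] by (simp_all add: nil_derivation.\<alpha>_def nil_derivation.\<beta>_def wx_def wy_def)

lemma e13: "\<e> 1 \<in> coords n" "\<e> 3 \<in> coords n"
  using n by (auto intro!: e_in simp del: One_nat_def)

lemma weights_add: "z \<in> L \<Longrightarrow> w \<in> L \<Longrightarrow> wx (z + w) = wx z + wx w" "z \<in> L \<Longrightarrow> w \<in> L \<Longrightarrow> wy (z + w) = wy z + wy w"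
  and weights_diff: "z \<in> L \<Longrightarrow> w \<in> L \<Longrightarrow> wx (z - w) = wx z - wx w" "z \<in> L \<Longrightarrow> w \<in> L \<Longrightarrow> wy (z - w) = wy z - wy w"
  and weights_scale: "z \<in> L \<Longrightarrow> wx (scale k z) = k * wx z" "z \<in> L \<Longrightarrow> wy (scale k z) = k * wy z"
  unfolding wx_def wy_def by (simp_all only: R_add R_diff R_scale e13 plus_fun_apply minus_apply cscale_apply)

lemma weights_N: "z \<in> N \<Longrightarrow> wx z = 0" "z \<in> N \<Longrightarrow> wy z = 0"
  unfolding wx_def wy_def R_N[OF _ e13(1)] R_N[OF _ e13(2)]
  using std_bracket_coords[OF e13(1) c_in n] std_bracket_coords[OF e13(2) c_in n] by simp_all

lemma R_3: "z \<in> L \<Longrightarrow> v \<in> coords n \<Longrightarrow> R z v 3 = wy z * v 3"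
  using nil_derivation.D_3[OF R_derivation] by (simp add: R_weights)

lemma R_1: "z \<in> L \<Longrightarrow> v \<in> coords n \<Longrightarrow> R z v 1 = wx z * v 1 + R z (\<e> 3) 1 * v 3"
  using nil_derivation.D_1[OF R_derivation] by (simp add: R_weights)

text \<open>\<open>R (br z w)\<close> is a commutator of triangular maps, so its diagonal vanishes.
  For \<open>wx\<close> the cross term in \<open>R_1\<close> drops out because
  \<open>R b (\<e> 1)\<close> has no coordinate 3.\<close>

lemma weights_bracket:
  assumes "z \<in> L" "w \<in> L"
  shows "wx (br z w) = 0" "wy (br z w) = 0"
proof -
  show "wy (br z w) = 0"
    unfolding wy_def using assms e13 by (simp add: R_bracket R_in R_3)
  have "R a (R b (\<e> 1)) 1 = wx a * wx b" if "a \<in> L" "b \<in> L" for a b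
    using R_1[OF that(1) R_in[OF that(2) e13(1)]] R_3[OF that(2) e13(1)] by (simp add: wx_def)
  then show "wx (br z w) = 0"
    unfolding wx_def using assms R_bracket[OF assms e13(1)] by simp
qed

text \<open>The lower series of \<open>M\<close> uses only right multiplications by
  \<open>M\<close>. From its first step on it lies in \<open>N\<close>, where derivations of weight
  zero are strictly triangular; so \<open>M\<close> is nilpotent and maximality of \<open>N\<close>
  applies.\<close>

lemma ideal_eq_N:
  assumes M: "two_sided_ideal scale L br M" and NM: "N \<subseteq> M"
    and wt: "\<And>z. z \<in> M \<Longrightarrow> wx z = 0 \<and> wy z = 0"
    and br_M: "\<And>z w. z \<in> M \<Longrightarrow> w \<in> M \<Longrightarrow> br z w \<in> N"
  shows "M = N"
proof -
  have M_in_L: "z \<in> L" if "z \<in> M" for z using M that by (auto simp: two_sided_ideal_def)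
  define P where "P V = {x \<in> N. c x \<in> V}" for V
  have subP: "subspace (P V)" if "cs.subspace V" for V
    using that cs.subspace_0[OF that] N_subspace c_scale[of 0 0]
    by (auto simp: subspace_def P_def c_add c_scale cs.subspace_def)
  have brP: "br x z \<in> P V'" if "x \<in> P V" "z \<in> M" "\<And>v. v \<in> coords n \<Longrightarrow> v \<in> V \<Longrightarrow> R z v \<in> V'" for x z V V'
    using that(1,2) that(3)[of "c x"] c_in[of x] by (auto simp: P_def br_N_left M_in_L R_def h_c)
  have stepP: "bracket_span scale br (P V) M \<subseteq> P V'"
    if "cs.subspace V'" "\<And>v z. v \<in> coords n \<Longrightarrow> v \<in> V \<Longrightarrow> z \<in> M \<Longrightarrow> R z v \<in> V'" for V V'
    using that brP by (intro bracket_span_subset subP) auto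
  define W where "W k = nil_derivation.W n k" for k
  have W: "W k = {u \<in> coords n. u 1 = 0 \<and> u 3 = 0 \<and> (\<forall>j \<in> {4..<k}. u j = 0)}" for k
    unfolding W_def by (rule nil_derivation.W_def[OF R_derivation[OF zero_in]])
  have subW: "cs.subspace (W k)" for k
    unfolding W_def by (rule nil_derivation.subspace_W[OF R_derivation[OF zero_in]])
  let ?V = "{v \<in> coords n. v 3 = 0}"
  have subV: "cs.subspace ?V" by (auto simp: cs.subspace_def coords_def)
  let ?ls = "lower_series scale br M"
  have mono: "?ls (Suc k) \<subseteq> P V'"
    if "?ls k \<subseteq> P V" "cs.subspace V'" "\<And>v z. v \<in> coords n \<Longrightarrow> v \<in> V \<Longrightarrow> z \<in> M \<Longrightarrow> R z v \<in> V'" for k V V'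
  proof -
    have "?ls (Suc k) \<subseteq> bracket_span scale br (P V) M"
      using that(1) unfolding lower_series.simps bracket_span_def by (intro span_mono) blast
    with stepP[OF that(2,3)] show ?thesis by blast
  qed
  \<comment> \<open>The coordinates die in the order 3, 1, then 4, ..., n, and finally 2.\<close>
  have 1: "?ls (Suc 0) \<subseteq> P UNIV"
    unfolding lower_series.simps
    by (intro bracket_span_subset subP) (auto simp: P_def br_M)
  have 2: "?ls (Suc (Suc 0)) \<subseteq> P ?V"
    by (rule mono[OF 1 subV]) (simp add: R_in M_in_L R_3 wt)
  have 3: "?ls (Suc (Suc (Suc k))) \<subseteq> P (W (k + 4))" for k
  proof (induct k)
    case 0
    show ?case
      by (rule mono[OF 2 subW]) (use R_1 in \<open>auto simp: W R_in M_in_L R_3 wt\<close>)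
  next
    case (Suc k)
    show ?case
    proof (rule mono[OF Suc subW])
      fix v z assume v: "v \<in> coords n" "v \<in> W (k + 4)" and z: "z \<in> M"
      have "R z v \<in> W (k + 4)"
        using v(2) unfolding W_def by (rule nil_derivation.D_W[OF R_derivation[OF M_in_L[OF z]]])
      moreover have "R z v (k + 4) = 0"
      proof (cases "k + 4 \<le> n")
        case True
        then show ?thesis
          using nil_derivation.D_k[OF R_derivation[OF M_in_L[OF z]] v(1), of "k + 4"] v(2) z
          by (simp add: W R_weights M_in_L wt)
      next
        case False
        with R_in[OF M_in_L[OF z] v(1)] show ?thesis by (simp add: coords_def)
      qed
      moreover have "{4..<Suc k + 4} = insert (k + 4) {4..<k + 4}" by auto
      ultimately show "R z v \<in> W (Suc k + 4)" unfolding W by simp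
    qed
  qed
  have "?ls (Suc (Suc (Suc (Suc (n - 3))))) \<subseteq> P {0}"
  proof (rule mono[OF 3])
    fix v z assume v: "v \<in> coords n" "v \<in> W (n - 3 + 4)" and z: "z \<in> M"
    have "R z v \<in> W (n - 3 + 4)"
      using v(2) unfolding W_def by (rule nil_derivation.D_W[OF R_derivation[OF M_in_L[OF z]]])
    moreover have "R z v 2 = 0"
      using nil_derivation.D_2[OF R_derivation[OF M_in_L[OF z]] v(1)] v(2) z
      by (simp add: W R_weights M_in_L wt)
    moreover have "k \<notin> {1..n} \<or> k = 1 \<or> k = 2 \<or> k = 3 \<or> k \<in> {4..<n - 3 + 4}" for k
      using n by auto
    ultimately have "R z v k = 0" for k
      unfolding W coords_def mem_Collect_eq by metis
    then show "R z v \<in> {0}" by (simp add: fun_eq_iff)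
  qed simp
  moreover have "P {0} \<subseteq> {0}"
    using h_c h_zero by (force simp: P_def)
  moreover have "0 \<in> ?ls (Suc (Suc (Suc (Suc (n - 3)))))"
    by (simp add: bracket_span_def span_zero)
  ultimately have "nilpotent_alg scale M br"
    unfolding nilpotent_alg_def by blast
  then show ?thesis
    using N_max M NM by (auto simp: maximal_nilpotent_ideal_def)
qed

section \<open>The nilradical as the kernel of the weight map\<close>

lemma bracket_span_ideal:
  assumes I: "two_sided_ideal scale L br I"
  shows "two_sided_ideal scale L br (bracket_span scale br I I)"
proof -
  let ?S = "bracket_span scale br I I"
  have IL: "x \<in> L" if "x \<in> I" for x using I that by (auto simp: two_sided_ideal_def)
  have Il: "br x y \<in> I" "br y x \<in> I" if "x \<in> I" "y \<in> L" for x y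
    using I that by (auto simp: two_sided_ideal_def)
  have S: "subspace ?S" by (simp add: bracket_span_def)
  have gen: "br x y \<in> ?S" if "x \<in> I" "y \<in> I" for x y
    using that by (auto simp: bracket_span_def intro: span_base)
  have SL: "?S \<subseteq> L" using IL by (intro bracket_span_subset subspace_carrier) (simp add: br_closed)
  let ?T = "{x \<in> L. \<forall>z \<in> L. br x z \<in> ?S \<and> br z x \<in> ?S}"
  have "?S \<subseteq> ?T"
  proof (rule bracket_span_subset)
    show "subspace ?T"
      using S by (auto simp: subspace_def zero_in add_in scale_in br_add_left br_add_right
          br_scale_left br_scale_right)
    fix a b assume ab: "a \<in> I" "b \<in> I"
    have "br (br a b) z \<in> ?S" "br z (br a b) \<in> ?S" if z: "z \<in> L" for z
    proof -
      have "br (br a b) z = br (br a z) b + br a (br b z)"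
        using ab z by (intro leibniz) (simp_all add: IL)
      then show "br (br a b) z \<in> ?S"
        using subspace_add[OF S gen[OF Il(1)[OF ab(1) z] ab(2)] gen[OF ab(1) Il(1)[OF ab(2) z]]]
        by simp
      \<comment> \<open>Solving the identity for the outer left multiplication leaves a difference
        of two brackets of elements of \<open>I\<close>.\<close>
      have "br (br z a) b = br (br z b) a + br z (br a b)"
        using ab z by (intro leibniz) (simp_all add: IL)
      then have "br z (br a b) = br (br z a) b - br (br z b) a" by simp
      then show "br z (br a b) \<in> ?S"
        using subspace_diff[OF S gen[OF Il(2)[OF ab(1) z] ab(2)] gen[OF Il(2)[OF ab(2) z] ab(1)]]
        by simp
    qed
    then show "br a b \<in> ?T" using ab by (simp add: br_closed IL)
  qed
  with S SL show ?thesis by (auto simp: two_sided_ideal_def)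
qed

lemma derived_series_ideal: "two_sided_ideal scale L br (derived_series scale br L k)"
  by (induct k)
    (simp_all add: bracket_span_ideal, simp add: two_sided_ideal_def subspace_carrier br_closed)

lemma weight_kernel_subspace: "subspace {z \<in> L. wx z = 0 \<and> wy z = 0}"
  using weights_N[of 0] subspace_0[OF N_subspace]
  by (auto simp: subspace_def zero_in add_in scale_in weights_add weights_scale)

text \<open>Downward induction along the derived series. The term \<open>I\<close> has weight zero,
  being spanned by brackets, and [I, I] is the next term, already in \<open>N\<close>; thus
  \<open>ideal_eq_N\<close> applies to N + I and gives I inside \<open>N\<close>.\<close>

lemma br_in_N:
  assumes "x \<in> L" "y \<in> L"
  shows "br x y \<in> N"
proof -
  obtain r where r: "derived_series scale br L r = {0}"
    using solvable by (auto simp: solvable_alg_def)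
  have "derived_series scale br L (Suc k) \<subseteq> N" if "k \<le> r" for k
    using that
  proof (induct rule: inc_induct)
    case base
    have "derived_series scale br L (Suc r) \<subseteq> {0}"
      unfolding derived_series.simps r by (rule bracket_span_subset) (auto simp: zero_in)
    then show ?case using subspace_0[OF N_subspace] by auto
  next
    case (step k)
    define I where "I = derived_series scale br L (Suc k)"
    have I: "two_sided_ideal scale L br I"
      unfolding I_def by (rule derived_series_ideal)
    have IL: "I \<subseteq> L" and subI: "subspace I" using I by (auto simp: two_sided_ideal_def)
    define M where "M = {a + b | a b. a \<in> N \<and> b \<in> I}"
    have "derived_series scale br L k \<subseteq> L"
      using derived_series_ideal[of k] by (simp add: two_sided_ideal_def)
    then have I_wt: "I \<subseteq> {z \<in> L. wx z = 0 \<and> wy z = 0}"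
      unfolding I_def derived_series.simps
      by (intro bracket_span_subset weight_kernel_subspace) (auto simp: weights_bracket br_closed subsetD)
    have brI: "br z w \<in> N" if "z \<in> I" "w \<in> I" for z w
    proof -
      have "br z w \<in> derived_series scale br L (Suc (Suc k))"
        using that unfolding I_def derived_series.simps(2)[of _ _ _ "Suc k"] bracket_span_def
        by (intro span_base) blast
      with step(3) show ?thesis by blast
    qed
    have "M = N"
    proof (rule ideal_eq_N)
      have subM: "subspace M" unfolding M_def by (rule subspace_sums[OF N_subspace subI])
      have "M \<subseteq> L" using N_sub IL by (auto simp: M_def intro!: add_in)
      moreover have "br x z \<in> M \<and> br z x \<in> M" if x: "x \<in> L" and z: "z \<in> M" for x z
      proof -
        obtain a b where ab: "z = a + b" "a \<in> N" "b \<in> I" using z by (auto simp: M_def)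
        then have "br x z = br x a + br x b" "br z x = br a x + br b x"
          using x subsetD[OF N_sub ab(2)] subsetD[OF IL ab(3)]
          by (simp_all add: ab(1) br_add_right br_add_left)
        moreover have "br x a \<in> N" "br a x \<in> N" using ab x by (simp_all add: br_N_left br_N_right)
        moreover have "br x b \<in> I" "br b x \<in> I" using ab x I by (simp_all add: two_sided_ideal_def)
        ultimately show ?thesis unfolding M_def by blast
      qed
      ultimately show "two_sided_ideal scale L br M"
        using subM by (simp add: two_sided_ideal_def)
      show "N \<subseteq> M" unfolding M_def using subspace_0[OF subI] by force
      show "wx z = 0 \<and> wy z = 0" if "z \<in> M" for z
        using that I_wt N_sub IL by (auto simp: M_def weights_add weights_N subset_iff)
      show "br z w \<in> N" if zw: "z \<in> M" "w \<in> M" for z w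
      proof -
        obtain a b a' b' where ab: "z = a + b" "a \<in> N" "b \<in> I" "w = a' + b'" "a' \<in> N" "b' \<in> I"
          using zw by (auto simp: M_def)
        then have L: "a \<in> L" "b \<in> L" "a' \<in> L" "b' \<in> L" using N_sub IL by auto
        have "br z w = (br a a' + br a b') + (br b a' + br b b')"
          using L by (simp add: ab br_add_left br_add_right add_in)
        then show ?thesis
          using ab L by (simp add: subspace_add[OF N_subspace] br_N_left br_N_right brI)
      qed
    qed
    moreover have "I \<subseteq> M" unfolding M_def using subspace_0[OF N_subspace] by force
    ultimately show ?case by (simp only: I_def)
  qed
  from this[of 0] have "bracket_span scale br L L \<subseteq> N" by simp
  moreover have "br x y \<in> bracket_span scale br L L"
    using assms by (auto simp: bracket_span_def intro: span_base)
  ultimately show ?thesis by blast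
qed

text \<open>Once [L, L] is known to lie in \<open>N\<close>, the whole kernel of the weight map
  meets the hypotheses of \<open>ideal_eq_N\<close>.\<close>

lemma weights_zero_in_N:
  assumes "z \<in> L" "wx z = 0" "wy z = 0"
  shows "z \<in> N"
proof -
  let ?K = "{z \<in> L. wx z = 0 \<and> wy z = 0}"
  have "?K = N"
  proof (rule ideal_eq_N)
    show NK: "N \<subseteq> ?K" using N_sub by (auto simp: weights_N)
    show "two_sided_ideal scale L br ?K"
      using weight_kernel_subspace by (auto simp: two_sided_ideal_def br_closed weights_bracket)
  qed (auto intro: br_in_N)
  with assms show ?thesis by blast
qed

section \<open>Surjectivity of the weight map\<close>

lemma N_spanned: "N \<subseteq> span ((\<lambda>i. h (\<e> i)) ` {1..n})"
proof
  fix x assume x: "x \<in> N"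
  have "h (\<Sum>i\<in>A. v i \<cdot> \<e> i) = (\<Sum>i\<in>A. scale (v i) (h (\<e> i)))" if "finite A" "A \<subseteq> {1..n}" for A v
    using that
  proof (induct A)
    case (insert i A)
    have ei: "\<e> i \<in> coords n" using insert by (intro e_in) auto
    moreover have "v i \<cdot> \<e> i \<in> coords n" by (rule cs.subspace_scale[OF subspace_coords ei])
    moreover have "(\<Sum>i\<in>A. v i \<cdot> \<e> i) \<in> coords n"
      using insert by (intro cs.subspace_sum cs.subspace_scale subspace_coords e_in) auto
    ultimately show ?case
      using insert by (simp add: h_add h_scale del: cscale_apply basis_vec_apply plus_fun_apply)
  qed (simp add: h_zero)
  from this[of "{1..n}" "c x"] have "h (c x) = (\<Sum>i=1..n. scale (c x i) (h (\<e> i)))"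
    by (simp only: coords_expand[OF c_in[OF x]]) auto
  moreover have "(\<Sum>i=1..n. scale (c x i) (h (\<e> i))) \<in> span ((\<lambda>i. h (\<e> i)) ` {1..n})"
    by (intro span_sum span_scale span_base) auto
  ultimately show "x \<in> span ((\<lambda>i. h (\<e> i)) ` {1..n})" by (simp add: h_c x)
qed

text \<open>A dimension count: \<open>n + 1\<close> vectors would span \<open>L\<close>. The choice
  \<open>z0 = 0\<close> covers the case of a vanishing weight map.\<close>

lemma no_line_complement:
  assumes "z0 \<in> L" and t: "\<And>z. z \<in> L \<Longrightarrow> \<exists>t. z - scale t z0 \<in> N"
  shows False
proof -
  let ?G = "insert z0 ((\<lambda>i. h (\<e> i)) ` {1..n})"
  have "L \<subseteq> span ?G"
  proof
    fix z assume "z \<in> L"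
    with t obtain t where "z - scale t z0 \<in> N" by blast
    then have "z - scale t z0 \<in> span ?G"
      using N_spanned span_mono[of "(\<lambda>i. h (\<e> i)) ` {1..n}" ?G] by blast
    moreover have "scale t z0 \<in> span ?G" by (intro span_scale span_base) auto
    ultimately have "(z - scale t z0) + scale t z0 \<in> span ?G" by (rule span_add)
    then show "z \<in> span ?G" by simp
  qed
  then have "dim L \<le> card ?G" by (intro dim_le_card) auto
  also have "\<dots> \<le> Suc (card ((\<lambda>i. h (\<e> i)) ` {1..n}))" by (rule card_insert_le_m1) auto
  also have "\<dots> \<le> Suc n" using card_image_le[of "{1..n}" "\<lambda>i. h (\<e> i)"] by simp
  finally show False using dim by simp
qed

lemma weights_surjective:
  "\<exists>T S. T \<in> L \<and> S \<in> L \<and> wx T = 1 \<and> wy T = 0 \<and> wx S = 0 \<and> wy S = 1"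
proof -
  have "\<exists>z \<in> L. \<exists>w \<in> L. wx z * wy w - wx w * wy z \<noteq> 0"
  proof (rule ccontr)
    \<comment> \<open>If all determinants vanish, the weights fill at most a line, and
      \<open>L\<close> would be \<open>N\<close> plus the multiples of one element.\<close>
    assume "\<not> ?thesis"
    then have det: "wx z * wy w - wx w * wy z = 0" if "z \<in> L" "w \<in> L" for z w
      using that by blast
    show False
    proof (cases "\<exists>z0 \<in> L. wx z0 \<noteq> 0 \<or> wy z0 \<noteq> 0")
      case True
      then obtain z0 where z0: "z0 \<in> L" "wx z0 \<noteq> 0 \<or> wy z0 \<noteq> 0" by blast
      have "\<exists>t. z - scale t z0 \<in> N" if z: "z \<in> L" for z
      proof -
        define t where "t = (if wx z0 = 0 then wy z / wy z0 else wx z / wx z0)"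
        have "wx z - t * wx z0 = 0" "wy z - t * wy z0 = 0"
          using det[OF z z0(1)] z0(2) by (auto simp: t_def field_simps)
        then have "z - scale t z0 \<in> N"
          using z z0(1) by (intro weights_zero_in_N) (simp_all add: diff_in scale_in weights_diff weights_scale)
        then show ?thesis ..
      qed
      then show False by (rule no_line_complement[OF z0(1)])
    next
      case False
      then have "\<exists>t. z - scale t 0 \<in> N" if "z \<in> L" for z
        using that by (auto intro: weights_zero_in_N)
      then show False by (rule no_line_complement[OF zero_in])
    qed
  qed
  then obtain z w where zw: "z \<in> L" "w \<in> L" "wx z * wy w - wx w * wy z \<noteq> 0" by blast
  define d where "d = wx z * wy w - wx w * wy z"
  \<comment> \<open>Cramer's rule for the weights (1, 0) and (0, 1).\<close>
  let ?T = "scale (1 / d) (scale (wy w) z - scale (wy z) w)"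
  let ?S = "scale (1 / d) (scale (wx z) w - scale (wx w) z)"
  have "wy w * wx z - wy z * wx w = d" "wx z * wy w - wx w * wy z = d" "d \<noteq> 0"
    using zw(3) by (auto simp: d_def algebra_simps)
  then have "?T \<in> L \<and> ?S \<in> L \<and> wx ?T = 1 \<and> wy ?T = 0 \<and> wx ?S = 0 \<and> wy ?S = 1"
    using zw by (simp add: scale_in diff_in weights_diff weights_scale)
  then show ?thesis by blast
qed

end

text \<open>Scalars 1 and -1 are left explicit so that the values have the shape
  \<open>k \<cdot> \<e> i\<close>, to which the evaluation of linear combinations in
  \<open>frame_iso_std\<close> applies.\<close>

lemma std_bracket_basis:
  assumes "n \<ge> 4" "k \<in> {3..n}" "l \<in> {3..n}"
  shows "std_bracket n (\<e> 1) (\<e> 1) = 0"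
    and "std_bracket n (\<e> 1) (\<e> 2) = 0"
    and "std_bracket n (\<e> 1) (\<e> k) = (if k < n then (-1) \<cdot> \<e> (Suc k) else 0)"
    and "std_bracket n (\<e> 1) (\<e> (n+1)) = 1 \<cdot> \<e> 1"
    and "std_bracket n (\<e> 1) (\<e> (n+2)) = 0"
    and "std_bracket n (\<e> 2) (\<e> 1) = 0"
    and "std_bracket n (\<e> 2) (\<e> 2) = 0"
    and "std_bracket n (\<e> 2) (\<e> k) = 0"
    and "std_bracket n (\<e> 2) (\<e> (n+1)) = 0"
    and "std_bracket n (\<e> 2) (\<e> (n+2)) = 2 \<cdot> \<e> 2"
    and "std_bracket n (\<e> k) (\<e> 1) = (if k < n then 1 \<cdot> \<e> (Suc k) else 0)"
    and "std_bracket n (\<e> k) (\<e> 2) = 0"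
    and "std_bracket n (\<e> k) (\<e> l) = (if k = 3 \<and> l = 3 then 1 \<cdot> \<e> 2 else 0)"
    and "std_bracket n (\<e> k) (\<e> (n+1)) = of_nat (k - 3) \<cdot> \<e> k"
    and "std_bracket n (\<e> k) (\<e> (n+2)) = 1 \<cdot> \<e> k"
    and "std_bracket n (\<e> (n+1)) (\<e> 1) = (-1) \<cdot> \<e> 1"
    and "std_bracket n (\<e> (n+1)) (\<e> 2) = 0"
    and "std_bracket n (\<e> (n+1)) (\<e> k) = (- of_nat (k - 3)) \<cdot> \<e> k"
    and "std_bracket n (\<e> (n+1)) (\<e> (n+1)) = 0"
    and "std_bracket n (\<e> (n+1)) (\<e> (n+2)) = 0"
    and "std_bracket n (\<e> (n+2)) (\<e> 1) = 0"
    and "std_bracket n (\<e> (n+2)) (\<e> 2) = 0"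
    and "std_bracket n (\<e> (n+2)) (\<e> k) = (-1) \<cdot> \<e> k"
    and "std_bracket n (\<e> (n+2)) (\<e> (n+1)) = 0"
    and "std_bracket n (\<e> (n+2)) (\<e> (n+2)) = 0"
  using assms by (auto simp: std_bracket_def fun_eq_iff)

section \<open>Adapted basis for an element of weight (1, \<i>)\<close>

locale L4_frame = L4_extension +
  fixes H :: 'a and x y :: "nat \<Rightarrow> complex"
  assumes H: "H \<in> L" and frame: "eigenframe n (R H) x y"
begin

interpretation eigenframe n "R H" x y by (rule frame)

interpretation Bl: bilinear_algebra cscale "coords n" "std_bracket n"
  by (rule bilinear_std_bracket[OF n order_refl])


definition commuting :: "'a \<Rightarrow> bool" where
  "commuting Z \<longleftrightarrow> Z \<in> L \<and> br Z H = 0"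

text \<open>[z, H] lies in \<open>N\<close>, where right multiplication by \<open>H\<close> is onto;
  subtracting a preimage makes the bracket with \<open>H\<close> vanish and changes no
  weight.\<close>

lemma commuting_shift:
  assumes z: "z \<in> L"
  shows "\<exists>Z. commuting Z \<and> wx Z = wx z \<and> wy Z = wy z"
proof -
  have "c (br z H) \<in> coords n" using z H by (simp add: c_in br_in_N)
  then obtain u where u: "u \<in> coords n" "R H u = c (br z H)" using D_surj by blast
  then have "br (h u) H = br z H"
    using h_R[OF H u(1)] z H by (simp add: h_c br_in_N)
  then have "commuting (z - h u)"
    using z H u by (simp add: commuting_def diff_in h_in_L br_diff_left)
  moreover have "wx (z - h u) = wx z" "wy (z - h u) = wy z"
    using z u by (simp_all add: weights_diff weights_N h_in h_in_L)
  ultimately show ?thesis by blast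
qed

text \<open>The bracket lies in \<open>N\<close> and is annihilated by right multiplication by
  \<open>H\<close>, for which 0 is not an eigenvalue there.\<close>

lemma commuting_bracket:
  assumes "commuting Z" "commuting Z'"
  shows "br Z Z' = 0"
proof -
  have Z: "Z \<in> L" "Z' \<in> L" "br Z H = 0" "br Z' H = 0" using assms by (auto simp: commuting_def)
  have N: "br Z Z' \<in> N" using Z by (simp add: br_in_N)
  have "br (br Z Z') H = br (br Z H) Z' + br Z (br Z' H)" using Z H by (intro leibniz)
  also have "\<dots> = 0" using Z by simp
  finally have "R H (c (br Z Z')) = 0"
    using N c_scale[of 0 0] subspace_0[OF N_subspace] by (simp add: R_def h_c)
  then have "c (br Z Z') = 0"
    using N by (intro eigen_vanish[of _ 0]) (simp_all add: c_in)
  then show ?thesis using h_c[OF N] h_zero by simp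
qed

context
  fixes Z assumes Z: "commuting Z"
begin

lemma Z_in: "Z \<in> L" and ZH: "br Z H = 0"
  using Z by (auto simp: commuting_def)

lemma R_commute: "v \<in> coords n \<Longrightarrow> R H (R Z v) = R Z (R H v)"
  using R_bracket[OF Z_in H, of v] h_in_L c_scale[of 0 0] subspace_0[OF N_subspace]
  by (simp add: ZH R_def[of 0])

text \<open>\<open>R Z\<close> commutes with \<open>R H\<close>, hence preserves the eigenline of
  \<open>x\<close>; coordinate 1 reads off the factor.\<close>

lemma R_Z_x: "R Z x = wx Z \<cdot> x"
proof -
  have "R H (R Z x) = R Z x" by (simp add: R_commute x_in D_x)
  from eigen_x[OF R_in[OF Z_in x_in] this] show ?thesis
    using R_1[OF Z_in x_in] by (simp add: x_1[simplified] x_3)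
qed

lemma R_Z_y: "R Z y = wy Z \<cdot> y"
proof -
  have "R H (R Z y) = \<i> \<cdot> R Z y"
    by (simp only: R_commute y_in D_y nil_derivation.D_scale[OF R_derivation[OF Z_in] y_in])
  from eigen_y[OF R_in[OF Z_in y_in] this] show ?thesis
    using R_3[OF Z_in y_in] by (simp add: y_3)
qed

lemma R_Z_Y: "R Z (Y j) = (of_nat j * wx Z + wy Z) \<cdot> Y j"
proof (induct j)
  case (Suc j)
  have "R Z (Y (Suc j)) = B (R Z (Y j)) x + B (Y j) (R Z x)"
    unfolding Y.simps by (rule nil_derivation.D_br[OF R_derivation[OF Z_in] Y_in x_in])
  then show ?case
    by (simp add: Suc R_Z_x) (simp add: std_bracket_def fun_eq_iff algebra_simps)
qed (simp add: R_Z_y)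

lemma R_Z_e2: "R Z (\<e> 2) = (2 * wy Z) \<cdot> \<e> 2"
  using nil_derivation.D_e2[OF R_derivation[OF Z_in]] by (simp only: R_weights Z_in)

text \<open>Left multiplication by \<open>Z\<close> on the nilradical, in coordinates. It obeys the
  rule \<open>l_br\<close> in place of the derivation rule.\<close>

definition l :: "(nat \<Rightarrow> complex) \<Rightarrow> nat \<Rightarrow> complex" where "l v = c (br Z (h v))"

lemma l_in: "v \<in> coords n \<Longrightarrow> l v \<in> coords n"
  and h_l: "v \<in> coords n \<Longrightarrow> h (l v) = br Z (h v)"
  by (simp_all add: l_def c_in br_N_right Z_in h_in h_c)

lemma l_scale: "v \<in> coords n \<Longrightarrow> l (k \<cdot> v) = k \<cdot> l v"
  by (simp add: l_def h_scale br_scale_right Z_in h_in_L c_scale br_N_right h_in)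

text \<open>The Leibniz identity with [Z, H] = 0. So left multiplication by \<open>Z\<close>
  preserves the eigenlines of \<open>R H\<close> as well.\<close>

lemma R_l:
  assumes v: "v \<in> coords n"
  shows "R H (l v) = l (R H v)"
  unfolding R_def[of H "l v"] h_l[OF v] l_def[of "R H v"] h_R[OF H v]
  using leibniz[OF Z_in h_in_L[OF v] H] by (simp add: ZH h_in_L v br_closed H)

lemma l_br: 
  assumes "u \<in> coords n" "v \<in> coords n"
  shows "l (B u v) = B (l u) v - B (l v) u"
proof -
  have "br (br Z (h u)) (h v) = br (br Z (h v)) (h u) + br Z (br (h u) (h v))"
    using assms by (intro leibniz Z_in h_in_L)
  then have "c (br (br Z (h u)) (h v)) = c (br (br Z (h v)) (h u)) + c (br Z (br (h u) (h v)))"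
    using assms by (simp add: c_add br_N_right Z_in h_in br_closed h_in_L)
  then show ?thesis
    using assms by (simp add: l_def h_br c_br c_h br_N_right Z_in h_in h_in_L)
qed

text \<open>By the Leibniz identity \<open>[Z, v] + [v, Z]\<close> is annihilated by right multiplication; this
  determines the left action of \<open>Z\<close> from the right one.\<close>

lemma B_l_R:
  assumes "w \<in> coords n" "v \<in> coords n"
  shows "B w (l v + R Z v) = 0"
proof -
  have L: "h w \<in> L" "h v \<in> L" "Z \<in> L" using assms h_in_L Z_in by auto
  have "br (br (h w) Z) (h v) = br (br (h w) (h v)) Z + br (h w) (br Z (h v))"
    by (rule leibniz[OF L(1) L(3) L(2)])
  then have "br (h w) (br Z (h v)) = br (br (h w) Z) (h v) - br (br (h w) (h v)) Z" by simp
  moreover have "br (br (h w) (h v)) Z = br (br (h w) Z) (h v) + br (h w) (br (h v) Z)"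
    by (rule leibniz[OF L])
  then have "br (h w) (br (h v) Z) = br (br (h w) (h v)) Z - br (br (h w) Z) (h v)" by simp
  ultimately have "br (h w) (br Z (h v)) + br (h w) (br (h v) Z) = 0" by simp
  then have "br (h w) (h (l v + R Z v)) = 0"
    using assms L by (simp add: h_add l_in R_in h_l h_R br_add_right br_closed)
  moreover have "l v + R Z v \<in> coords n"
    using assms L by (intro cs.subspace_add subspace_coords l_in R_in)
  ultimately have "h (B w (l v + R Z v)) = 0" using assms by (simp add: h_br)
  then have "c (h (B w (l v + R Z v))) = 0"
    using c_scale[of 0 0] subspace_0[OF N_subspace] by simp
  moreover have "B w (l v + R Z v) \<in> coords n"
    using B_in assms \<open>l v + R Z v \<in> coords n\<close> by blast
  ultimately show ?thesis by (simp add: c_h)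
qed

text \<open>By \<open>B_l_R\<close> the vector \<open>l x + R Z x\<close>, a multiple of
  \<open>x\<close>, is annihilated by \<open>B y\<close>. Since \<open>B y x\<close> has coordinate
  4 equal to 1, the factor is zero.\<close>

lemma l_x: "l x = (- wx Z) \<cdot> x"
proof -
  have "R H (l x) = l x" by (simp add: R_l x_in D_x)
  from eigen_x[OF l_in[OF x_in] this] have lx: "l x = l x 1 \<cdot> x" .
  have "l x + R Z x = (l x 1 + wx Z) \<cdot> x"
    by (subst lx) (simp add: R_Z_x fun_eq_iff algebra_simps)
  then have "B y ((l x 1 + wx Z) \<cdot> x) = 0" using B_l_R[OF y_in x_in] by simp
  then have "(l x 1 + wx Z) \<cdot> B y x = 0"
    by (simp only: Bl.br_scale_right y_in x_in)
  moreover have "B y x 4 = 1" using Y_Suc(2)[of 0] n by simp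
  ultimately have "l x 1 + wx Z = 0" by (metis cscale_apply mult.right_neutral zero_fun_apply)
  then have "l x 1 = - wx Z" by (simp only: eq_neg_iff_add_eq_0)
  from lx[unfolded this] show ?thesis .
qed

text \<open>As for \<open>l_x\<close>, now with \<open>B y y = \<e> 2\<close> as the nonzero
  bracket.\<close>

lemma l_y: "l y = (- wy Z) \<cdot> y"
proof -
  have "R H (l y) = \<i> \<cdot> l y" by (simp only: R_l y_in D_y l_scale)
  from eigen_y[OF l_in[OF y_in] this] have ly: "l y = l y 3 \<cdot> y" .
  have "l y + R Z y = (l y 3 + wy Z) \<cdot> y"
    by (subst ly) (simp add: R_Z_y fun_eq_iff algebra_simps)
  then have "B y ((l y 3 + wy Z) \<cdot> y) = 0" using B_l_R[OF y_in y_in] by simp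
  moreover have "B y ((l y 3 + wy Z) \<cdot> y) 2 = l y 3 + wy Z"
    using y_in by (simp add: std_bracket_def y_3 coords_def)
  ultimately have "l y 3 + wy Z = 0" by simp
  then have "l y 3 = - wy Z" by (simp only: eq_neg_iff_add_eq_0)
  from ly[unfolded this] show ?thesis .
qed

text \<open>For \<open>\<e> 2 = B y y\<close> the rule \<open>l_br\<close> gives a difference of two
  equal terms.\<close>

lemma l_e2: "l (\<e> 2) = 0"
  using l_br[OF y_in y_in] by (simp only: B_y_y) simp

lemma l_Y: "l (Y j) = (- (of_nat j * wx Z + wy Z)) \<cdot> Y j"
proof (induct j)
  case (Suc j)
  have "l (Y (Suc j)) = B (l (Y j)) x - B (l x) (Y j)"
    unfolding Y.simps by (rule l_br[OF Y_in x_in])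
  also have "B (l x) (Y j) = (- wx Z) \<cdot> B x (Y j)"
    by (simp only: l_x Bl.br_scale_left x_in Y_in)
  also have "\<dots> = wx Z \<cdot> Y (Suc j)" by (simp only: B_x_Y cs.scale_minus_left cs.scale_minus_right minus_minus)
  also have "B (l (Y j)) x = (- (of_nat j * wx Z + wy Z)) \<cdot> Y (Suc j)"
    by (simp only: Suc Bl.br_scale_left x_in Y_in Y.simps)
  finally have "l (Y (Suc j)) = (- (of_nat j * wx Z + wy Z)) \<cdot> Y (Suc j) - wx Z \<cdot> Y (Suc j)" .
  moreover have "- (of_nat j * wx Z + wy Z) - wx Z = - (of_nat (Suc j) * wx Z + wy Z)"
    by (simp add: algebra_simps)
  ultimately show ?case by (simp only: cs.scale_left_diff_distrib[symmetric])
qed (simp add: l_y)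

lemma br_Z:
  "br (h x) Z = scale (wx Z) (h x)" "br Z (h x) = scale (- wx Z) (h x)"
  "br (h (\<e> 2)) Z = scale (2 * wy Z) (h (\<e> 2))" "br Z (h (\<e> 2)) = 0"
  "br (h (Y j)) Z = scale (of_nat j * wx Z + wy Z) (h (Y j))"
  "br Z (h (Y j)) = scale (- (of_nat j * wx Z + wy Z)) (h (Y j))"
proof -
  have e2: "\<e> 2 \<in> coords n" using n by (intro basis_vec_in_coords) auto
  show "br (h x) Z = scale (wx Z) (h x)" "br Z (h x) = scale (- wx Z) (h x)"
    by (simp_all only: h_R[OF Z_in x_in, symmetric] h_l[OF x_in, symmetric] R_Z_x l_x h_scale[OF x_in])
  show "br (h (\<e> 2)) Z = scale (2 * wy Z) (h (\<e> 2))" "br Z (h (\<e> 2)) = 0"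
    by (simp_all only: h_R[OF Z_in e2, symmetric] h_l[OF e2, symmetric] R_Z_e2 l_e2 h_scale[OF e2] h_zero)
  show "br (h (Y j)) Z = scale (of_nat j * wx Z + wy Z) (h (Y j))"
    "br Z (h (Y j)) = scale (- (of_nat j * wx Z + wy Z)) (h (Y j))"
    by (simp_all only: h_R[OF Z_in Y_in, symmetric] h_l[OF Y_in, symmetric] R_Z_Y l_Y h_scale[OF Y_in])
qed

end

lemma br_frame:
  "br (h x) (h x) = 0" "br (h x) (h (Y j)) = - h (Y (Suc j))" "br (h (Y j)) (h x) = h (Y (Suc j))"
  "br (h (Y i)) (h (Y j)) = (if i = 0 \<and> j = 0 then h (\<e> 2) else 0)"
  "v \<in> coords n \<Longrightarrow> br (h (\<e> 2)) (h v) = 0" "v \<in> coords n \<Longrightarrow> br (h v) (h (\<e> 2)) = 0"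
proof -
  have e2: "\<e> 2 \<in> coords n" using n by (intro basis_vec_in_coords) auto
  show "br (h x) (h x) = 0" by (simp add: B_x_x h_zero x_in flip: h_br)
  show "br (h x) (h (Y j)) = - h (Y (Suc j))" "br (h (Y j)) (h x) = h (Y (Suc j))"
    by (simp_all only: h_br[OF x_in Y_in, symmetric] h_br[OF Y_in x_in, symmetric] B_x_Y B_Y_x
        h_uminus[OF Y_in])
  show "br (h (Y i)) (h (Y j)) = (if i = 0 \<and> j = 0 then h (\<e> 2) else 0)"
    unfolding h_br[OF Y_in Y_in, symmetric]
    by (cases "i = 0 \<and> j = 0") (auto simp: B_y_y B_Y_Y h_zero)
  show "br (h (\<e> 2)) (h v) = 0" "br (h v) (h (\<e> 2)) = 0" if "v \<in> coords n"
    by (simp_all only: h_br[OF e2 that, symmetric] h_br[OF that e2, symmetric] B_e2[OF that] h_zero)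
qed

lemma N_subset_span: "N \<subseteq> span ({h x, h (\<e> 2)} \<union> (\<lambda>j. h (Y j)) ` {..n - 3})" (is "_ \<subseteq> span ?S")
proof
  fix u assume u: "u \<in> N"
  have e2: "\<e> 2 \<in> coords n" using n by (intro basis_vec_in_coords) auto
  let ?V = "{v \<in> coords n. h v \<in> span ?S}"
  have "cs.subspace ?V"
    using subspace_coords[of n]
    by (auto simp: cs.subspace_def h_add h_scale h_zero span_zero span_add span_scale)
  moreover have "{x, \<e> 2} \<union> Y ` {..n - 3} \<subseteq> ?V"
    using x_in e2 Y_in by (auto intro!: span_base)
  ultimately have "coords n \<subseteq> ?V"
    using coords_subset_span cs.span_minimal by (meson order_trans)
  with c_in[OF u] show "u \<in> span ?S" using h_c[OF u] by auto
qed

text \<open>Elements T and S of weights (1, 0) and (0, 1) can be taken commuting with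
  \<open>H\<close>; their brackets with the eigenvectors are then determined by weights, and all
  structure constants are the standard ones.\<close>

lemma frame_iso_std: "alg_isomorphic scale L br cscale (coords (n + 2)) (std_bracket n)"
proof -
  obtain T0 S0 where "T0 \<in> L" "S0 \<in> L" "wx T0 = 1" "wy T0 = 0" "wx S0 = 0" "wy S0 = 1"
    using weights_surjective by blast
  then obtain T S where T: "commuting T" "wx T = 1" "wy T = 0" and S: "commuting S" "wx S = 0" "wy S = 1"
    using commuting_shift[of T0] commuting_shift[of S0] by auto
  have TS: "T \<in> L" "S \<in> L" using T S by (auto simp: commuting_def)
  have e2: "\<e> 2 \<in> coords n" using n by (intro basis_vec_in_coords) auto
  define b where "b i = (if i = 1 then h x else if i = 2 then h (\<e> 2) else if i \<le> n then h (Y (i - 3))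
    else if i = n + 1 then T else S)" for i
  have bs: "b 1 = h x" "b 2 = h (\<e> 2)" "3 \<le> i \<Longrightarrow> i \<le> n \<Longrightarrow> b i = h (Y (i - 3))"
    "b (n + 1) = T" "b (n + 2) = S" for i
    using n by (auto simp: b_def)
  have span: "L \<subseteq> span (b ` {1..n+2})"
  proof
    fix z assume z: "z \<in> L"
    have "z - scale (wx z) T - scale (wy z) S \<in> N"
      using z TS T S by (intro weights_zero_in_N)
        (simp_all add: diff_in scale_in weights_diff weights_scale)
    moreover have "{h x, h (\<e> 2)} \<union> (\<lambda>j. h (Y j)) ` {..n - 3} \<subseteq> b ` {1..n+2}"
    proof -
      have "h (Y j) \<in> b ` {1..n+2}" if "j \<le> n - 3" for j
        using that n bs(3)[of "j + 3"] by (intro image_eqI[of _ _ "j + 3"]) auto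
      then show ?thesis using bs(1,2) n by (auto intro: image_eqI[of _ _ 1] image_eqI[of _ _ 2])
    qed
    ultimately have "z - scale (wx z) T - scale (wy z) S \<in> span (b ` {1..n+2})"
      using N_subset_span span_mono by blast
    moreover have "scale (wx z) T \<in> span (b ` {1..n+2})"
      by (intro span_scale span_base image_eqI[of _ _ "n+1"]) (use n in \<open>auto simp: b_def\<close>)
    moreover have "scale (wy z) S \<in> span (b ` {1..n+2})"
      by (intro span_scale span_base image_eqI[of _ _ "n+2"]) (use n in \<open>auto simp: b_def\<close>)
    ultimately have "(z - scale (wx z) T - scale (wy z) S) + scale (wx z) T + scale (wy z) S \<in> span (b ` {1..n+2})"
      by (intro span_add)
    then show "z \<in> span (b ` {1..n+2})" by simp
  qed
  define comb where "comb v = (\<Sum>l=1..n+2. scale (v l) (b l))" for v :: "nat \<Rightarrow> complex"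
  have comb: "comb (k \<cdot> \<e> i) = scale k (b i)" if "i \<in> {1..n+2}" for k i
  proof -
    have "comb (k \<cdot> \<e> i) = (\<Sum>l=1..n+2. if l = i then scale k (b i) else 0)"
      unfolding comb_def by (rule sum.cong) auto
    with that show ?thesis by simp
  qed
  have comb0: "comb 0 = 0" by (simp add: comb_def)
  \<comment> \<open>At \<open>k = n\<close> the next chain member is zero by \<open>Y_zero\<close>,
    matching the end of the chain in \<open>std_bracket_basis\<close>.\<close>
  have next_b: "h (Y (Suc (k - 3))) = (if k < n then b (Suc k) else 0)" if "k \<in> {3..n}" for k
  proof (cases "k < n")
    case True
    have "Suc k - 3 = Suc (k - 3)" using that by auto
    from bs(3)[of "Suc k", unfolded this] that True show ?thesis by (simp del: Y.simps)
  next
    case False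
    with that Y_zero[of "Suc (k - 3)"] show ?thesis by (simp add: h_zero del: Y.simps)
  qed
  note brackets = br_frame br_frame(5,6)[OF x_in] br_frame(5,6)[OF e2] br_frame(5,6)[OF Y_in]
    br_Z[OF T(1)] br_Z[OF S(1)] T(2,3) S(2,3) commuting_bracket T(1) S(1) next_b
  have hom: "br (b i) (b j) = comb (std_bracket n (\<e> i) (\<e> j))"
    if ij: "i \<in> {1..n+2}" "j \<in> {1..n+2}" for i j
  proof -
    have cases: "i = 1 \<or> i = 2 \<or> i \<in> {3..n} \<or> i = n + 1 \<or> i = n + 2" if "i \<in> {1..n+2}" for i
      using that by auto
    have b: "b 1 = h x" "b 2 = h (\<e> 2)" "b (n + 1) = T" "b (n + 2) = S" by (fact bs)+
    have bk: "b k = h (Y (k - 3))" "k \<in> {1..n+2}" "Suc k \<in> {1..n+2}" if "k \<in> {3..n}" for k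
      using that bs(3)[of k] by auto
    have c: "comb (k \<cdot> \<e> 1) = scale k (h x)" "comb (k \<cdot> \<e> 2) = scale k (h (\<e> 2))" for k
      using comb[of 1 k] comb[of 2 k] b(1,2) by simp_all
    have c': "comb (k \<cdot> \<e> l) = scale k (h (Y (l - 3)))"
      "comb (if l < n then k \<cdot> \<e> (Suc l) else 0) = scale k (h (Y (Suc (l - 3))))"
      if "l \<in> {3..n}" for k l
      using comb[of l k] comb[of "Suc l" k] comb0 bk[OF that] next_b[OF that] by simp_all
    have c'': "comb (if k = 3 \<and> l = 3 then 1 \<cdot> \<e> 2 else 0) =
        (if k - 3 = 0 \<and> l - 3 = 0 then h (\<e> 2) else 0)" if "k \<in> {3..n}" "l \<in> {3..n}" for k l
      using that c(2)[of 1] comb0 by (cases "k = 3 \<and> l = 3") auto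
    have 3: "3 \<in> {3..n}" using n by simp
    note std = std_bracket_basis(1,2,4-7,9,10,16,17,19-22,24,25)[OF n 3 3]
      std_bracket_basis(3,8,11,12,14,15,18,23)[OF n _ 3] std_bracket_basis(13)[OF n]
    show ?thesis
      using cases[OF ij(1)] cases[OF ij(2)]
      by (elim disjE) (simp_all only: b bk std c c' c'' comb0 brackets, simp_all)
  qed
  show ?thesis
  proof (rule alg_isomorphic_of_basis[OF bilinear_algebra bilinear_std_bracket[OF n] dim _ span])
    show "b i \<in> L" if "i \<in> {1..n+2}" for i
      using that n TS x_in e2 Y_in by (auto simp: b_def h_in_L)
  qed (use hom in \<open>simp_all add: comb_def\<close>)
qed

end

section \<open>Conclusion of the classification\<close>

context L4_extension
begin

lemma iso_std: "alg_isomorphic scale L br cscale (coords (n + 2)) (std_bracket n)"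
proof -
  obtain T S where TS: "T \<in> L" "S \<in> L" "wx T = 1" "wy T = 0" "wx S = 0" "wy S = 1"
    using weights_surjective by blast
  \<comment> \<open>Weight (1, \<i>) is what makes \<open>R H\<close> a regular derivation.\<close>
  define H where "H = T + scale \<i> S"
  have H: "H \<in> L" "wx H = 1" "wy H = \<i>"
    using TS by (simp_all add: H_def add_in scale_in weights_add weights_scale)
  then have reg: "regular_derivation n (R H)"
    by (intro regular_derivation.intro R_derivation regular_derivation_axioms.intro)
      (simp_all add: R_weights)
  then obtain x y where "x \<in> coords n" "y \<in> coords n" "R H x = x" "R H y = \<i> \<cdot> y"
    "x 1 = 1" "x 3 = 0" "y 3 = 1"
    using regular_derivation.eigenvectors_exist by blast
  then have "eigenframe n (R H) x y"
    by (intro eigenframe.intro reg eigenframe_axioms.intro)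
  then have "L4_frame scale L br n N c H x y"
    by (intro L4_frame.intro L4_extension_axioms L4_frame_axioms.intro H(1))
  then show ?thesis by (rule L4_frame.frame_iso_std)
qed

end

lemma solvable_ext_iso_std:
  assumes n: "n \<ge> 4" and ext: "solvable_ext_of_L4 n scale L br"
  shows "alg_isomorphic scale L br cscale (coords (n + 2)) (std_bracket n)"
proof -
  have leib: "leibniz_algebra scale L br" and dim: "vector_space.dim scale L = n + 2"
    and solv: "solvable_alg scale L br"
    using ext by (simp_all add: solvable_ext_of_L4_def)
  obtain N where N: "is_nilradical scale L br N"
    "alg_isomorphic scale N br cscale (coords n) (L4_bracket n)"
    using ext by (auto simp: solvable_ext_of_L4_def)
  obtain f where f: "bij_betw f N (coords n)"
    "\<And>x y. x \<in> N \<Longrightarrow> y \<in> N \<Longrightarrow> f (x + y) = f x + f y"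
    "\<And>k x. x \<in> N \<Longrightarrow> f (scale k x) = k \<cdot> f x"
    "\<And>x y. x \<in> N \<Longrightarrow> y \<in> N \<Longrightarrow> f (br x y) = std_bracket n (f x) (f y)"
    using alg_isomorphic_trans[OF N(2) L4_iso_std[OF n]] unfolding alg_isomorphic_def by blast
  have "maximal_nilpotent_ideal scale L br N" using N(1) by (simp add: is_nilradical_def)
  then have "L4_extension scale L br n N f"
    by (intro L4_extension.intro L4_extension_axioms.intro leib
        leibniz_algebra.bilinear_algebra[OF leib] n dim solv f)
  then show ?thesis by (rule L4_extension.iso_std)
qed

theorem theorem5p1p4:
  fixes n :: nat
    and scale :: "complex \<Rightarrow> 'a::ab_group_add \<Rightarrow> 'a"
    and L :: "'a set"
    and br :: "'a \<Rightarrow> 'a \<Rightarrow> 'a"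
  assumes "n \<ge> 4"
  shows "(n \<ge> 5 \<longrightarrow> solvable_ext_of_L4 n cscale (coords (n + 2)) (g1_bracket n)) \<and>
    (n = 4 \<longrightarrow>
      (\<forall>b. admissible2 b \<longrightarrow> solvable_ext_of_L4 4 cscale (coords 6) (g2_bracket b)) \<and>
      (\<forall>c. admissible3 c \<longrightarrow> solvable_ext_of_L4 4 cscale (coords 6) (g3_bracket c)) \<and>
      (\<forall>b. admissible4 b \<longrightarrow> solvable_ext_of_L4 4 cscale (coords 6) (g4_bracket b))) \<and>
    (solvable_ext_of_L4 n scale L br \<longrightarrow>
      (n \<ge> 5 \<and> alg_isomorphic scale L br cscale (coords (n + 2)) (g1_bracket n)) \<or>
      (n = 4 \<and>
        ((\<exists>b. admissible2 b \<and> alg_isomorphic scale L br cscale (coords 6) (g2_bracket b)) \<or>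
         (\<exists>c. admissible3 c \<and> alg_isomorphic scale L br cscale (coords 6) (g3_bracket c)) \<or>
         (\<exists>b. admissible4 b \<and> alg_isomorphic scale L br cscale (coords 6) (g4_bracket b)))))"
proof (intro conjI impI)
  assume ext: "solvable_ext_of_L4 n scale L br"
  have std: "alg_isomorphic scale L br cscale (coords (n + 2)) (std_bracket n)"
    using assms ext by (rule solvable_ext_iso_std)
  show "(n \<ge> 5 \<and> alg_isomorphic scale L br cscale (coords (n + 2)) (g1_bracket n)) \<or>
      (n = 4 \<and>
        ((\<exists>b. admissible2 b \<and> alg_isomorphic scale L br cscale (coords 6) (g2_bracket b)) \<or>
         (\<exists>c. admissible3 c \<and> alg_isomorphic scale L br cscale (coords 6) (g3_bracket c)) \<or>
         (\<exists>b. admissible4 b \<and> alg_isomorphic scale L br cscale (coords 6) (g4_bracket b))))"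
  proof (cases "n \<ge> 5")
    case True
    have "alg_isomorphic scale L br cscale (coords (n + 2)) (g1_bracket n)"
      using std alg_isomorphic_sym[OF g1_iso_std[OF assms] bilinear_g_brackets(1)[OF assms]]
      by (rule alg_isomorphic_trans)
    with True show ?thesis by simp
  next
    case False
    then have n: "n = 4" using assms by simp
    \<comment> \<open>For \<open>n = 4\<close> every extension is isomorphic to the standard
      algebra, so one admissible representative suffices; \<open>b = 0\<close> in the second family
      is chosen.\<close>
    have "alg_isomorphic cscale (coords 6) (std_bracket 4) cscale (coords 6) (g2_bracket 0)"
      by (rule alg_isomorphic_sym[OF g2_iso_std bilinear_g_brackets(2)]) simp
    then have "alg_isomorphic scale L br cscale (coords 6) (g2_bracket 0)"
      using std n by (auto intro: alg_isomorphic_trans)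
    moreover have "admissible2 0" by (simp add: admissible2_iff)
    ultimately show ?thesis using n by blast
  qed
qed (use assms solvable_ext_g in auto)

end
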